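(* Let $\alpha_1,\alpha_2\in(\tfrac12,1)$ with $\alpha_1+\alpha_2-1=\alpha$, and suppose $n-|\tau_0|>4$. For any finite sample size $n$ and any (arbitrarily small) $\delta>0$, there exists a constant $\gamma_\delta\in(0,1)$ such that, when $$\lambda\in\Big[4n\gamma_\delta^{1/2}\Big\{2+2(|\tau_0|+1)\frac{\log(p/2)}{n}\Big\}\sigma_0^2,\ \frac{n\gamma_\delta^{1/4}}{6}C_{\min}\Big],$$ the joint confidence set $\Gamma_\alpha^{\eta_\tau}$ satisfies $$\mathbb P_{(\mathcal U^d,Y)}\{(\tau_0,\beta_0)\in\Gamma_\alpha^{\eta_\tau}(Y)\}\ge\alpha-\delta-o(e^{-c_1d})\quad(d\to\infty)$$ for some $c_1>0$. Further, $\mathbb P_{Y|\mathcal U^d}\{(\tau_0,\beta_0)\in\Gamma_\alpha^{\eta_\tau}(Y)\}\ge\alpha-\delta-o_p(e^{-c_1d})$.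
   Context: Setting. $n,p$ are positive integers and $X\in\mathbb R^{n\times p}$ is a fixed matrix. For $\tau\subset[p]=\{1,\dots,p\}$ (a "model"), $X_\tau$ is the submatrix of the columns of $X$ indexed by $\tau$, $|\tau|$ is the cardinality, and $H_\tau$ is the orthogonal projection matrix onto the column span of $X_\tau$. The data are $Y=X_{\tau_0}\beta_0+\sigma_0U$, where $\tau_0\subset[p]$ (nonempty), $\beta_0\in\mathbb R^{|\tau_0|}$, $\sigma_0>0$ are fixed and $U\sim N(0,I_n)$. Identifiability: $\tau_0$ is the unique model of smallest cardinality in $\{\tau\subset[p]: X_\tau\beta_\tau=X_{\tau_0}\beta_0\text{ for some }\beta_\tau\}$. Define $$C_{\min}=\min_{\tau\ne\tau_0,\ |\tau|\le|\tau_0|}\ \min_{\beta_\tau\in\mathbb R^{|\tau|}}\ \frac{\|X_{\tau_0}\beta_0-X_\tau\beta_\tau\|_2^2}{n\max(|\tau_0\setminus\tau|,1)}>0.$$ Candidate set. $\mathcal U^d=(U_1^*,\dots,U_d^* )$ are i.i.d. $N(0,I_n)$, independent of $U$. For $\lambda>0$, $\hat\tau_b=\arg\min_{\tau}\min_{\beta_\tau\in\mathbb R^{|\tau|},\sigma\in\mathbb R}\{\|Y-X_\tau\beta_\tau-\sigma U_b^*\|_2^2+\lambda|\tau|\}$ (fixed tie-breaking rule) and $S^{(d)}=\{\hat\tau_b:b=1,\dots,d\}$. Model confidence set. For $y\in\mathbb R^n$ and a model $\tau$ let $\tilde T_0(y,\tau)=\arg\min_{\tilde\tau\subset[p],|\tilde\tau|\le|\tau|}\min_{\beta_{\tilde\tau}}\|y-X_{\tilde\tau}\beta_{\tilde\tau}\|^2$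 (fixed tie-breaking rule) and $\widetilde W(y,\tau)=(H_\tau y,\|(I-H_\tau)y\|)$. For $w=(a,b)$ let $p_{(w,\tau)}(\tau')=\mathbb P_V\{\tilde T_0(a+b\,(I-H_\tau)V/\|(I-H_\tau)V\|,\tau)=\tau'\}$ with $V\sim N(0,I_n)$, and for a level $\alpha_1$ let $$B_{\alpha_1}(\tau,w)=\Big\{\tau^*\subset[p]:\sum_{\tau':\,p_{(w,\tau)}(\tau')\le p_{(w,\tau)}(\tau^* )}p_{(w,\tau)}(\tau')\ge1-\alpha_1\Big\},\quad \bar\Gamma^\tau_{\alpha_1}(y)=\{\tau\in S^{(d)}:\tilde T_0(y,\tau)\in B_{\alpha_1}(\tau,\widetilde W(y,\tau))\}.$$ Joint confidence set. For $\eta_\tau=(\tau,\beta_\tau)$ let $$\tilde T(y,\eta_\tau)=\frac{(y-X_\tau\beta_\tau)^\top H_\tau(y-X_\tau\beta_\tau)/|\tau|}{(y-X_\tau\beta_\tau)^\top(I-H_\tau)(y-X_\tau\beta_\tau)/(n-|\tau|)}$$ and $B_{\alpha_2}(\eta_\tau)=[0,F^{-1}_{|\tau|,n-|\tau|}(\alpha_2)]$ with $F^{-1}_{k,m}$ the quantile function of the $F$ distribution with $(k,m)$ degrees of freedom (any fixed convention when $|\tau|=0$ or $|\tau|\ge n$). Then $$\Gamma_\alpha^{\eta_\tau}(y)=\bigcup_{\tau\in\bar\Gamma^\tau_{\alpha_1}(y)}\{\eta_\tau=(\tau,\beta_\tau):\tilde T(y,\eta_\tau)\in B_{\alpha_2}(\eta_\tau)\}.$$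 $\mathbb P_{(\mathcal U^d,Y)}$ is the joint probability over $U$ and $\mathcal U^d$; $\mathbb P_{Y|\mathcal U^d}$ is the conditional probability given $\mathcal U^d$, and $o_p$ is with respect to $\mathcal U^d$ as $d\to\infty$. *)

theory Defs
  imports "HOL-Probability.Probability"
begin

section \<open>Linear models\<close>

text \<open>
  The design matrix is \<open>X :: real ^ 'p ^ 'n\<close>, so that \<open>n = CARD('n)\<close> and \<open>p = CARD('p)\<close>, and a model
  is a set \<open>\<tau> :: 'p set\<close> of column indices. A coefficient vector in \<open>R^|\<tau>|\<close> is represented by the
  vector in \<open>R^p\<close> that carries it on the coordinates in \<open>\<tau>\<close> and is zero elsewhere; \<open>coeff_space \<tau>\<close> is the
  set of these vectors.
\<close>

definition coeff_space :: "'p set \<Rightarrow> (real ^ 'p) set" where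
  "coeff_space \<tau> = {\<beta>. \<forall>j. j \<notin> \<tau> \<longrightarrow> \<beta> $ j = 0}"

text \<open>The product of the submatrix of the columns in \<open>\<tau>\<close> with \<open>\<beta>\<close>.\<close>

definition model_mean :: "real ^ 'p ^ 'n \<Rightarrow> 'p set \<Rightarrow> real ^ 'p \<Rightarrow> real ^ 'n" where
  "model_mean X \<tau> \<beta> = (\<Sum>j\<in>\<tau>. (\<beta> $ j) *\<^sub>R column j X)"

definition column_span :: "real ^ 'p ^ 'n \<Rightarrow> 'p set \<Rightarrow> (real ^ 'n) set" where
  "column_span X \<tau> = span ((\<lambda>j. column j X) ` \<tau>)"

definition is_orth_proj :: "real ^ 'n ^ 'n \<Rightarrow> (real ^ 'n) set \<Rightarrow> bool" where
  "is_orth_proj H S \<longleftrightarrow> (\<forall>y. H *v y \<in> S \<and> (\<forall>z\<in>S. orthogonal (y - H *v y) z))"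

definition proj_mat :: "real ^ 'p ^ 'n \<Rightarrow> 'p set \<Rightarrow> real ^ 'n ^ 'n" where
  "proj_mat X \<tau> = (THE H. is_orth_proj H (column_span X \<tau>))"

lemma orth_proj_point_unique:
  fixes S :: "(real ^ 'n) set"
  assumes "subspace S" "u \<in> S" "v \<in> S"
    and "\<And>z. z \<in> S \<Longrightarrow> orthogonal (y - u) z" "\<And>z. z \<in> S \<Longrightarrow> orthogonal (y - v) z"
  shows "u = v"
proof -
  have "u - v \<in> S"
    using assms(1-3) by (rule subspace_diff)
  then have "(y - v) \<bullet> (u - v) = 0" "(y - u) \<bullet> (u - v) = 0"
    using assms(4,5) by (auto simp: orthogonal_def)
  then have "(u - v) \<bullet> (u - v) = 0"
    by (simp add: inner_diff_left)
  then show ?thesis by simp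
qed

lemma ex1_orth_proj:
  fixes S :: "(real ^ 'n) set"
  assumes S: "subspace S"
  shows "\<exists>!H. is_orth_proj H S"
proof -
  have "\<exists>u. u \<in> S \<and> (\<forall>z\<in>S. orthogonal (y - u) z)" for y
  proof -
    obtain u v where "u \<in> span S" "\<And>w. w \<in> span S \<Longrightarrow> orthogonal v w" "y = u + v"
      using orthogonal_subspace_decomp_exists[of S y] by metis
    moreover have "span S = S"
      using S by (simp add: span_eq_iff)
    ultimately show ?thesis
      by (intro exI[of _ u]) auto
  qed
  then obtain P where P: "\<And>y. P y \<in> S" "\<And>y z. z \<in> S \<Longrightarrow> orthogonal (y - P y) z"
    by metis
  have lin: "linear P"
  proof (rule linearI)
    fix a b :: "real ^ 'n" and c :: real
    show "P (a + b) = P a + P b"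
    proof (rule orth_proj_point_unique[OF S, where y = "a + b"])
      show "orthogonal (a + b - (P a + P b)) z" if "z \<in> S" for z
        using P(2)[OF that, of a] P(2)[OF that, of b]
        by (simp add: orthogonal_def inner_diff_left inner_add_left)
    qed (use P S in \<open>auto intro: subspace_add\<close>)
    show "P (c *\<^sub>R a) = c *\<^sub>R P a"
    proof (rule orth_proj_point_unique[OF S, where y = "c *\<^sub>R a"])
      show "orthogonal (c *\<^sub>R a - c *\<^sub>R P a) z" if "z \<in> S" for z
        using P(2)[OF that, of a]
        by (simp add: orthogonal_def inner_diff_left)
    qed (use P S in \<open>auto intro: subspace_scale\<close>)
  qed
  have "is_orth_proj (matrix P) S"
    using P by (simp add: is_orth_proj_def matrix_works[OF linear_matrix_vector_mul_eq[THEN iffD2, OF lin]])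
  moreover have "H = K" if "is_orth_proj H S" "is_orth_proj K S" for H K
  proof -
    have "H *v y = K *v y" for y
      using that orth_proj_point_unique[OF S, of "H *v y" "K *v y" y]
      by (auto simp: is_orth_proj_def)
    then show ?thesis by (simp add: matrix_eq)
  qed
  ultimately show ?thesis by blast
qed

lemma is_orth_proj_proj_mat: "is_orth_proj (proj_mat X \<tau>) (column_span X \<tau>)"
  unfolding proj_mat_def column_span_def by (rule theI'[OF ex1_orth_proj]) simp

text \<open>\<open>(I - H) y\<close>.\<close>

definition resid :: "real ^ 'p ^ 'n \<Rightarrow> 'p set \<Rightarrow> real ^ 'n \<Rightarrow> real ^ 'n" where
  "resid X \<tau> y = (mat 1 - proj_mat X \<tau>) *v y"

definition identifiable :: "real ^ 'p ^ 'n \<Rightarrow> 'p set \<Rightarrow> real ^ 'p \<Rightarrow> bool" where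
  "identifiable X \<tau>0 \<beta>0 \<longleftrightarrow>
     {\<tau>. is_arg_min card (\<lambda>\<tau>. \<exists>\<beta>\<in>coeff_space \<tau>. model_mean X \<tau> \<beta> = model_mean X \<tau>0 \<beta>0) \<tau>} = {\<tau>0}"

definition C_min :: "real ^ 'p ^ 'n \<Rightarrow> 'p set \<Rightarrow> real ^ 'p \<Rightarrow> real" where
  "C_min X \<tau>0 \<beta>0 =
     (MIN \<tau>\<in>{\<tau>. \<tau> \<noteq> \<tau>0 \<and> card \<tau> \<le> card \<tau>0}.
        INF \<beta>\<in>coeff_space \<tau>. (norm (model_mean X \<tau>0 \<beta>0 - model_mean X \<tau> \<beta>))\<^sup>2
                         / (real CARD('n) * real (max (card (\<tau>0 - \<tau>)) 1)))"

definition response :: "real ^ 'p ^ 'n \<Rightarrow> 'p set \<Rightarrow> real ^ 'p \<Rightarrow> real \<Rightarrow> real ^ 'n \<Rightarrow> real ^ 'n" where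
  "response X \<tau>0 \<beta>0 \<sigma>0 u = model_mean X \<tau>0 \<beta>0 + \<sigma>0 *\<^sub>R u"


section \<open>Distributions\<close>

text \<open>The law \<open>N(0, I)\<close> on \<open>R^n\<close>.\<close>

definition std_gaussian :: "(real ^ 'n) measure" where
  "std_gaussian = density lborel (\<lambda>x. ennreal (\<Prod>i\<in>UNIV. std_normal_density (x $ i)))"

text \<open>
  The \<open>F\<close> distribution is the law of the ratio of two independent chi-square variables, each divided
  by its degrees of freedom. (If \<open>k = 0\<close> or \<open>m = 0\<close>, division by zero makes it the point mass at \<open>0\<close>.)
\<close>

definition F_distribution :: "nat \<Rightarrow> nat \<Rightarrow> real measure" where
  "F_distribution k m =
     distr (PiM {..<k + m} (\<lambda>_. density lborel std_normal_density)) borel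
       (\<lambda>z. ((\<Sum>i<k. (z i)\<^sup>2) / real k) / ((\<Sum>i=k..<k + m. (z i)\<^sup>2) / real m))"

definition quantile :: "real measure \<Rightarrow> real \<Rightarrow> real" where
  "quantile \<mu> q = Inf {x. q \<le> cdf \<mu> x}"


section \<open>The confidence sets\<close>

text \<open>A tie-breaking rule picks one of the minimizing models from the set of all of them.\<close>

definition tie_rule :: "('p set set \<Rightarrow> 'p set) \<Rightarrow> bool" where
  "tie_rule sel \<longleftrightarrow> (\<forall>A. A \<noteq> {} \<longrightarrow> sel A \<in> A)"

definition cand_obj :: "real ^ 'p ^ 'n \<Rightarrow> real \<Rightarrow> real ^ 'n \<Rightarrow> real ^ 'n \<Rightarrow> 'p set \<Rightarrow> real" where
  "cand_obj X lam y u \<tau> =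
     (INF (\<beta>, \<sigma>)\<in>coeff_space \<tau> \<times> (UNIV :: real set).
        (norm (y - model_mean X \<tau> \<beta> - \<sigma> *\<^sub>R u))\<^sup>2 + lam * real (card \<tau>))"

definition tau_hat ::
  "('p set set \<Rightarrow> 'p set) \<Rightarrow> real ^ 'p ^ 'n \<Rightarrow> real \<Rightarrow> real ^ 'n \<Rightarrow> real ^ 'n \<Rightarrow> 'p set" where
  "tau_hat sel X lam y u = sel {\<tau>. is_arg_min (cand_obj X lam y u) (\<lambda>_. True) \<tau>}"

text \<open>The copies are indexed from \<open>0\<close>: the first \<open>d\<close> of them are \<open>us 0, \<dots>, us (d - 1)\<close>.\<close>

definition cand_set ::
  "('p set set \<Rightarrow> 'p set) \<Rightarrow> real ^ 'p ^ 'n \<Rightarrow> real \<Rightarrow> nat \<Rightarrow> (nat \<Rightarrow> real ^ 'n) \<Rightarrow> real ^ 'n \<Rightarrow> 'p set set"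
  where "cand_set sel X lam d us y = (\<lambda>b. tau_hat sel X lam y (us b)) ` {..<d}"

definition T0 ::
  "('p set set \<Rightarrow> 'p set) \<Rightarrow> real ^ 'p ^ 'n \<Rightarrow> real ^ 'n \<Rightarrow> 'p set \<Rightarrow> 'p set" where
  "T0 sel X y \<tau> =
     sel {\<tau>'. is_arg_min (\<lambda>\<tau>'. INF \<beta>\<in>coeff_space \<tau>'. (norm (y - model_mean X \<tau>' \<beta>))\<^sup>2)
                (\<lambda>\<tau>'. card \<tau>' \<le> card \<tau>) \<tau>'}"

definition W_stat :: "real ^ 'p ^ 'n \<Rightarrow> real ^ 'n \<Rightarrow> 'p set \<Rightarrow> (real ^ 'n) \<times> real" where
  "W_stat X y \<tau> = (proj_mat X \<tau> *v y, norm (resid X \<tau> y))"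

definition model_prob ::
  "('p set set \<Rightarrow> 'p set) \<Rightarrow> real ^ 'p ^ 'n \<Rightarrow> (real ^ 'n) \<times> real \<Rightarrow> 'p set \<Rightarrow> 'p set \<Rightarrow> real" where
  "model_prob sel X w \<tau> \<tau>' =
     measure std_gaussian
       {v. T0 sel X (fst w + snd w *\<^sub>R (resid X \<tau> v /\<^sub>R norm (resid X \<tau> v))) \<tau> = \<tau>'}"

definition B_model ::
  "('p set set \<Rightarrow> 'p set) \<Rightarrow> real ^ 'p ^ 'n \<Rightarrow> real \<Rightarrow> 'p set \<Rightarrow> (real ^ 'n) \<times> real \<Rightarrow> 'p set set" where
  "B_model sel X \<alpha>1 \<tau> w =
     {\<tau>s. (\<Sum>\<tau>'\<in>{\<tau>'. model_prob sel X w \<tau> \<tau>' \<le> model_prob sel X w \<tau> \<tau>s}.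
             model_prob sel X w \<tau> \<tau>') \<ge> 1 - \<alpha>1}"

text \<open>
  \<open>sel\<close> breaks the ties in the candidate set and \<open>selT\<close> those in \<open>T0\<close>; \<open>us\<close> are the values of the
  artificial noise copies.
\<close>

definition model_conf_set ::
  "('p set set \<Rightarrow> 'p set) \<Rightarrow> ('p set set \<Rightarrow> 'p set) \<Rightarrow> real ^ 'p ^ 'n \<Rightarrow> real \<Rightarrow> real \<Rightarrow>
   nat \<Rightarrow> (nat \<Rightarrow> real ^ 'n) \<Rightarrow> real ^ 'n \<Rightarrow> 'p set set" where
  "model_conf_set sel selT X lam \<alpha>1 d us y =
     {\<tau> \<in> cand_set sel X lam d us y. T0 selT X y \<tau> \<in> B_model selT X \<alpha>1 \<tau> (W_stat X y \<tau>)}"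

definition T_stat :: "real ^ 'p ^ 'n \<Rightarrow> real ^ 'n \<Rightarrow> 'p set \<Rightarrow> real ^ 'p \<Rightarrow> real" where
  "T_stat X y \<tau> \<beta> =
     (let r = y - model_mean X \<tau> \<beta> in
       (r \<bullet> (proj_mat X \<tau> *v r) / real (card \<tau>))
       / (r \<bullet> ((mat 1 - proj_mat X \<tau>) *v r) / real (CARD('n) - card \<tau>)))"

definition B_coeff :: "nat \<Rightarrow> real \<Rightarrow> 'p set \<Rightarrow> real set" where
  "B_coeff n \<alpha>2 \<tau> = {0..quantile (F_distribution (card \<tau>) (n - card \<tau>)) \<alpha>2}"

definition joint_conf_set ::
  "('p set set \<Rightarrow> 'p set) \<Rightarrow> ('p set set \<Rightarrow> 'p set) \<Rightarrow> real ^ 'p ^ 'n \<Rightarrow> real \<Rightarrow> real \<Rightarrow> real \<Rightarrow>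
   nat \<Rightarrow> (nat \<Rightarrow> real ^ 'n) \<Rightarrow> real ^ 'n \<Rightarrow> ('p set \<times> (real ^ 'p)) set" where
  "joint_conf_set sel selT X lam \<alpha>1 \<alpha>2 d us y =
     (\<Union>\<tau>\<in>model_conf_set sel selT X lam \<alpha>1 d us y.
        {(\<tau>, \<beta>) | \<beta>. \<beta> \<in> coeff_space \<tau> \<and> T_stat X y \<tau> \<beta> \<in> B_coeff (CARD('n)) \<alpha>2 \<tau>})"


section \<open>Conditional probability and stochastic order\<close>

text \<open>The \<open>\<sigma>\<close>-algebra on the sample space generated by \<open>Us 0, \<dots>, Us (d - 1)\<close>.\<close>

definition gen_sigma :: "'a measure \<Rightarrow> nat \<Rightarrow> (nat \<Rightarrow> 'a \<Rightarrow> real ^ 'n) \<Rightarrow> 'a measure" where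
  "gen_sigma M d Us =
     vimage_algebra (space M) (\<lambda>\<omega>. \<lambda>b\<in>{..<d}. Us b \<omega>) (PiM {..<d} (\<lambda>_. borel))"

definition cond_prob_given :: "'a measure \<Rightarrow> 'a measure \<Rightarrow> 'a set \<Rightarrow> 'a \<Rightarrow> real" where
  "cond_prob_given M G A = real_cond_exp M G (indicator A)"

text \<open>\<open>R d = o_p(g d)\<close> as \<open>d\<close> tends to infinity, for positive \<open>g\<close>.\<close>

definition small_op :: "'a measure \<Rightarrow> (nat \<Rightarrow> 'a \<Rightarrow> real) \<Rightarrow> (nat \<Rightarrow> real) \<Rightarrow> bool" where
  "small_op M R g \<longleftrightarrow>
     (\<forall>\<epsilon>>0. (\<lambda>d. measure M {\<omega> \<in> space M. \<bar>R d \<omega>\<bar> > \<epsilon> * g d}) \<longlonglongrightarrow> 0)"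

end

theory Submission
  imports Defs
begin

text \<open>
  The event that \<open>(\<tau>\<^sub>0, \<beta>\<^sub>0)\<close> is covered is the intersection of three events. Given \<open>H Y\<close> and
  \<open>\<parallel>(I - H) Y\<parallel>\<close>, with \<open>H\<close> the projection of the true model, the direction of \<open>(I - H) Y\<close> has the
  law used in \<open>model_prob\<close>, so the discrete set \<open>B_model\<close> has conditional level \<open>\<alpha>1\<close>; identifiability
  makes the columns of the true model independent, so the second statistic is exactly \<open>F\<close>-distributed.

  For the candidate set, if an artificial noise copy equalled the noise \<open>u\<close>, the true model would have
  objective \<open>\<lambda> |\<tau>\<^sub>0|\<close>, and every other model of at most this size would pay the squared distance of the
  true mean from the span of its columns and \<open>u\<close>. This distance is almost surely positive, hence above
  some \<open>\<epsilon>\<close> outside an event of probability \<open>\<delta>\<close>, and \<open>\<gamma>\<close> is chosen so that \<open>\<lambda> |\<tau>\<^sub>0| \<le> \<epsilon>\<close>. By continuity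
  the true model wins on a neighbourhood of \<open>u\<close>, which each copy hits with positive probability, so
  that, away from an event of small probability, missing it \<open>d\<close> times is exponentially unlikely.
\<close>

section \<open>Rotation invariance of the standard Gaussian law\<close>

text \<open>The constant \<gamma> has to be fixed before \<open>lam\<close>, whereas the probability
  that a copy selects the true model depends on \<open>lam\<close> and on the noise, and no uniform
  positive lower bound for it is at hand. Two thresholds are therefore used: one on the signal gap,
  which knows \<delta> but not \<open>lam\<close>, and one on the hit probability, chosen after
  \<open>lam\<close>. The hit probability is positive wherever the gap exceeds its threshold, and
  the inequality with \<open>1 - \<delta>\<close> is strict, so continuity from below passes from
  one threshold to the other without spending a second \<delta>. The rate \<open>c1\<close> comes
  from the second threshold and may depend on \<open>lam\<close>. Both distributional facts rest on
  one picture: in an orthonormal basis adapted to the column span, a standard Gaussian vector has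
  independent standard normal coordinates, the projection being one block of them and the residual
  the other. The conditional law of the residual direction is never constructed; an integral
  identity in which the direction is redrawn takes its place.\<close>

lemma borel_measurable_linear:
  fixes f :: "'a::euclidean_space \<Rightarrow> 'b::euclidean_space"
  shows "linear f \<Longrightarrow> f \<in> borel_measurable borel"
  by (intro borel_measurable_continuous_onI linear_continuous_on linear_conv_bounded_linear[THEN iffD1])

text \<open>
  The image measure \<open>\<nu>\<close> is translation invariant. Integrating \<open>indicator B y * indicator A (x + y)\<close> in both
  orders shows that it is proportional to Lebesgue measure; the unit ball \<open>B\<close>, which \<open>T\<close> preserves, fixes
  the constant.
\<close>

lemma lborel_distr_orthogonal:
  fixes T :: "'a::euclidean_space \<Rightarrow> 'a"
  assumes T: "orthogonal_transformation T"
  shows "distr lborel borel T = lborel"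
proof -
  define \<nu> where "\<nu> = distr lborel borel T"
  have \<nu>_sets [measurable_cong, simp]: "sets \<nu> = sets borel"
    by (simp add: \<nu>_def)
  have lin: "linear T" and nT: "norm (T x) = norm x" for x
    using T by (auto simp: orthogonal_transformation)
  interpret T: linear T by fact
  have [measurable]: "T \<in> borel_measurable borel"
    using lin by (rule borel_measurable_linear)
  have surj: "\<exists>w. T w = x" for x
    using orthogonal_transformation_surj[OF T] by (metis surjD)
  have transl: "(\<integral>\<^sup>+x. f (x + y) \<partial>lborel) = (\<integral>\<^sup>+x. f x \<partial>lborel)"
    if [measurable]: "f \<in> borel_measurable borel" for f :: "'a \<Rightarrow> ennreal" and y
  proof -
    have "(\<integral>\<^sup>+x. f x \<partial>lborel) = (\<integral>\<^sup>+x. f x \<partial>distr lborel borel ((+) y))"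
      by (simp add: lborel_distr_plus)
    then show ?thesis
      by (simp add: \<nu>_def nn_integral_distr add.commute)
  qed
  have transl': "(\<integral>\<^sup>+x. f (x + y) \<partial>\<nu>) = (\<integral>\<^sup>+x. f x \<partial>\<nu>)"
    if [measurable]: "f \<in> borel_measurable borel" for f :: "'a \<Rightarrow> ennreal" and y
  proof -
    obtain w where w: "T w = y" using surj by blast
    have "(\<integral>\<^sup>+x. f (x + y) \<partial>\<nu>) = (\<integral>\<^sup>+x. f (T (x + w)) \<partial>lborel)"
      by (simp add: \<nu>_def nn_integral_distr T.add w)
    also have "\<dots> = (\<integral>\<^sup>+x. f (T x) \<partial>lborel)"
      by (rule transl[of "\<lambda>x. f (T x)"]) measurable
    finally show ?thesis
      by (simp add: \<nu>_def nn_integral_distr)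
  qed
  define B :: "'a set" where "B = ball 0 1"
  have [measurable]: "B \<in> sets borel"
    by (simp add: B_def)
  have \<nu>B: "emeasure \<nu> B = emeasure lborel B"
    by (auto simp: \<nu>_def B_def emeasure_distr nT intro!: arg_cong2[where f = emeasure])
  have fin: "emeasure lborel B < \<infinity>"
    by (rule emeasure_bounded_finite) (simp add: B_def)
  have pos: "emeasure lborel B > 0"
    using content_ball_pos[of 1 "0::'a"] by (auto simp: B_def measure_def zero_less_iff_neq_zero)
  \<comment> \<open>Needed for exchanging the integrals. Centred balls are preserved by
    \<open>T\<close>, so their \<open>\<nu>\<close>-measures are their finite volumes.\<close>
  interpret \<nu>: sigma_finite_measure \<nu>
  proof
    show "\<exists>A. countable A \<and> A \<subseteq> sets \<nu> \<and> \<Union>A = space \<nu> \<and> (\<forall>a\<in>A. emeasure \<nu> a \<noteq> \<infinity>)"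
    proof (intro exI[of _ "range (\<lambda>k::nat. ball 0 (real k))"] conjI ballI)
      show "\<Union> (range (\<lambda>k::nat. ball 0 (real k))) = space \<nu>"
        by (auto simp: \<nu>_def reals_Archimedean2)
      fix a :: "'a set" assume "a \<in> range (\<lambda>k::nat. ball 0 (real k))"
      then obtain k :: nat where "a = ball 0 (real k)" by auto
      then have "emeasure \<nu> a = emeasure lborel (ball (0::'a) (real k))"
        by (auto simp: \<nu>_def B_def emeasure_distr nT intro!: arg_cong2[where f = emeasure])
      then show "emeasure \<nu> a \<noteq> \<infinity>"
        using emeasure_lborel_ball_finite[of "0::'a" "real k"] by simp
    qed auto
  qed
  interpret P: pair_sigma_finite lborel \<nu> ..
  have "\<nu> = lborel"
  proof (rule measure_eqI)
    fix A assume "A \<in> sets \<nu>"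
    then have [measurable]: "A \<in> sets borel" by simp
    have "emeasure lborel A * emeasure \<nu> B
        = (\<integral>\<^sup>+y. indicator B y * (\<integral>\<^sup>+x. indicator A x \<partial>lborel) \<partial>\<nu>)"
      by (subst mult.commute[of "indicator B _"]) (simp add: nn_integral_cmult_indicator)
    also have "\<dots> = (\<integral>\<^sup>+y. (\<integral>\<^sup>+x. indicator B y * indicator A (x + y) \<partial>lborel) \<partial>\<nu>)"
      by (simp add: nn_integral_cmult transl del: nn_integral_indicator)
    also have "\<dots> = (\<integral>\<^sup>+x. (\<integral>\<^sup>+y. indicator B y * indicator A (x + y) \<partial>\<nu>) \<partial>lborel)"
      by (rule P.Fubini') measurable
    also have "\<dots> = (\<integral>\<^sup>+x. (\<integral>\<^sup>+y. indicator B (y - x) * indicator A y \<partial>\<nu>) \<partial>lborel)"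
    proof (rule nn_integral_cong)
      fix x
      show "(\<integral>\<^sup>+y. indicator B y * indicator A (x + y) \<partial>\<nu>) = (\<integral>\<^sup>+y. indicator B (y - x) * indicator A y \<partial>\<nu>)"
        using transl'[of "\<lambda>y. indicator B (y - x) * indicator A y" x] by (simp add: add.commute)
    qed
    also have "\<dots> = (\<integral>\<^sup>+y. (\<integral>\<^sup>+x. indicator B (y - x) * indicator A y \<partial>lborel) \<partial>\<nu>)"
      by (rule P.Fubini'[symmetric]) measurable
    \<comment> \<open>The ball is symmetric about 0, so the inner integrand is again a translate of
      its indicator and integrates to its volume.\<close>
    also have "\<dots> = (\<integral>\<^sup>+y. (\<integral>\<^sup>+x. indicator B (x - y) \<partial>lborel) * indicator A y \<partial>\<nu>)"
      by (simp add: nn_integral_multc B_def indicator_def dist_norm norm_minus_commute)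
    also have "\<dots> = emeasure lborel B * emeasure \<nu> A"
      using transl[of "indicator B" "- y" for y]
      by (simp add: nn_integral_cmult)
    finally have "emeasure lborel B * emeasure lborel A = emeasure lborel B * emeasure \<nu> A"
      by (simp add: \<nu>B mult.commute)
    then show "emeasure \<nu> A = emeasure lborel A"
      using pos fin by (auto simp: ennreal_mult_cancel_left)
  qed simp
  then show ?thesis
    by (simp add: \<nu>_def)
qed

text \<open>Boxes determine a product measure, and on a box the integral of a product of
  one-variable functions factors.\<close>

lemma PiM_density:
  fixes f :: "'b::euclidean_space \<Rightarrow> ennreal"
  assumes I: "finite I" and [measurable]: "f \<in> borel_measurable borel"
    and sf: "sigma_finite_measure (density lborel f)"
  shows "PiM I (\<lambda>_. density lborel f) = density (PiM I (\<lambda>_. lborel)) (\<lambda>z. \<Prod>i\<in>I. f (z i))"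
proof -
  interpret D: product_sigma_finite "\<lambda>_. density lborel f"
    by (simp add: product_sigma_finite_def sf)
  interpret L: product_sigma_finite "\<lambda>_. lborel :: 'b measure" ..
  have sets: "sets (PiM I (\<lambda>_. density lborel f)) = sets (PiM I (\<lambda>_. lborel))"
    by (intro sets_PiM_cong) auto
  show ?thesis
  proof (rule D.PiM_eqI[symmetric, OF I])
    show "sets (density (PiM I (\<lambda>_. lborel)) (\<lambda>z. \<Prod>i\<in>I. f (z i))) = sets (PiM I (\<lambda>_. density lborel f))"
      using sets by simp
    fix A :: "'a \<Rightarrow> 'b set" assume A: "\<And>i. i \<in> I \<Longrightarrow> A i \<in> sets (density lborel f)"
    then have [measurable]: "i \<in> I \<Longrightarrow> A i \<in> sets borel" for i by simp
    have "emeasure (density (PiM I (\<lambda>_. lborel)) (\<lambda>z. \<Prod>i\<in>I. f (z i))) (Pi\<^sub>E I A)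
       = (\<integral>\<^sup>+z. (\<Prod>i\<in>I. f (z i)) * indicator (Pi\<^sub>E I A) z \<partial>PiM I (\<lambda>_. lborel))"
      using I by (subst emeasure_density) (auto intro!: sets_PiM_I_finite)
    also have "\<dots> = (\<integral>\<^sup>+z. (\<Prod>i\<in>I. f (z i) * indicator (A i) (z i)) \<partial>PiM I (\<lambda>_. lborel))"
    proof (rule nn_integral_cong)
      fix z :: "'a \<Rightarrow> 'b" assume "z \<in> space (PiM I (\<lambda>_. lborel))"
      then have "z \<in> extensional I" by (auto simp: space_PiM PiE_def)
      then show "(\<Prod>i\<in>I. f (z i)) * indicator (Pi\<^sub>E I A) z = (\<Prod>i\<in>I. f (z i) * indicator (A i) (z i))"
        using I by (auto simp: prod.distrib indicator_def PiE_iff prod_zero_iff)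
    qed
    also have "\<dots> = (\<Prod>i\<in>I. \<integral>\<^sup>+x. f x * indicator (A i) x \<partial>lborel)"
      by (rule L.product_nn_integral_prod) (use I in auto)
    also have "\<dots> = (\<Prod>i\<in>I. emeasure (density lborel f) (A i))"
      by (intro prod.cong) (auto simp: emeasure_density)
    finally show "emeasure (density (PiM I (\<lambda>_. lborel)) (\<lambda>z. \<Prod>i\<in>I. f (z i))) (Pi\<^sub>E I A)
      = (\<Prod>i\<in>I. emeasure (density lborel f) (A i))" .
  qed
qed

section \<open>Standard Gaussian vectors in orthonormal coordinates\<close>

abbreviation std_normal :: "real measure" where
  "std_normal \<equiv> density lborel (\<lambda>x. ennreal (std_normal_density x))"

lemma prob_space_std_normal: "prob_space std_normal"
  using prob_space_normal_density[of 1 0] by simp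

lemma PiM_std_normal:
  assumes "finite I"
  shows "PiM I (\<lambda>_. std_normal)
    = density (PiM I (\<lambda>_. lborel)) (\<lambda>z. ennreal (\<Prod>i\<in>I. std_normal_density (z i)))"
proof -
  interpret prob_space std_normal by (rule prob_space_std_normal)
  show ?thesis
    by (subst PiM_density[OF assms]) (auto simp: prod_ennreal intro: sigma_finite_measure_axioms)
qed

text \<open>The exponents of the coordinate densities add up to the squared norm; in this form
  invariance under norm-preserving maps is visible.\<close>

lemma std_gaussian_eq_density_norm:
  "(std_gaussian :: (real ^ 'n) measure)
    = density lborel (\<lambda>x. ennreal ((1 / sqrt (2 * pi)) ^ CARD('n) * exp (- (norm x)\<^sup>2 / 2)))"
proof -
  have "(\<Prod>i\<in>UNIV. std_normal_density (x $ i))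
      = (1 / sqrt (2 * pi)) ^ CARD('n) * exp (- (norm x)\<^sup>2 / 2)" for x :: "real ^ 'n"
    by (simp add: std_normal_density_def prod.distrib power_divide exp_sum[symmetric] sum_negf
        sum_divide_distrib[symmetric] norm_vec_def L2_set_def sum_nonneg prod_dividef)
  then show ?thesis
    unfolding std_gaussian_def by simp
qed

lemma std_gaussian_distr_orthogonal:
  fixes T :: "real ^ 'n \<Rightarrow> real ^ 'n"
  assumes T: "orthogonal_transformation T"
  shows "distr std_gaussian borel T = std_gaussian"
proof -
  have nT: "norm (T x) = norm x" and lin: "linear T" for x
    using T by (auto simp: orthogonal_transformation)
  have [measurable]: "T \<in> borel_measurable borel"
    using lin by (rule borel_measurable_linear)
  let ?g = "\<lambda>x :: real ^ 'n. ennreal ((1 / sqrt (2 * pi)) ^ CARD('n) * exp (- (norm x)\<^sup>2 / 2))"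
  have "density (distr lborel borel T) ?g = distr (density lborel (?g \<circ> T)) borel T"
    by (subst density_distr) (auto simp: comp_def)
  then show ?thesis
    by (simp add: std_gaussian_eq_density_norm lborel_distr_orthogonal[OF T] comp_def nT)
qed

text \<open>\<open>lborel_eq\<close> presents Lebesgue measure as the image of a product over
  \<open>Basis\<close>, and the density factors along the same coordinates. This leads from a
  density to independent coordinates.\<close>

lemma std_gaussian_eq_distr_Basis:
  "(std_gaussian :: (real ^ 'n) measure)
    = distr (PiM Basis (\<lambda>_. std_normal)) borel (\<lambda>f. \<Sum>b\<in>Basis. f b *\<^sub>R b)"
proof -
  let ?S = "\<lambda>f. \<Sum>b\<in>Basis. f b *\<^sub>R b :: real ^ 'n"
  let ?g = "\<lambda>x :: real ^ 'n. ennreal (\<Prod>b\<in>Basis. std_normal_density (x \<bullet> b))"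
  have g: "(\<Prod>i\<in>UNIV. std_normal_density (x $ i)) = (\<Prod>b\<in>Basis. std_normal_density (x \<bullet> b))"
    for x :: "real ^ 'n"
  proof -
    have "bij_betw (\<lambda>i. axis i (1::real) :: real ^ 'n) UNIV Basis"
      by (auto simp: bij_betw_def inj_on_def axis_eq_axis Basis_vec_def)
    from prod.reindex_bij_betw[OF this, of "\<lambda>b. std_normal_density (x \<bullet> b)"]
    show ?thesis by (simp add: inner_axis)
  qed
  have "std_gaussian = density (distr (\<Pi>\<^sub>M b\<in>Basis. lborel) borel ?S) ?g"
    unfolding std_gaussian_def g lborel_eq[symmetric] ..
  also have "\<dots> = distr (density (\<Pi>\<^sub>M b\<in>Basis. lborel) (\<lambda>f. ?g (?S f))) borel ?S"
    by (subst density_distr) auto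
  also have "(\<lambda>f. ?g (?S f)) = (\<lambda>f. ennreal (\<Prod>b\<in>Basis. std_normal_density (f b)))"
    by (auto intro!: prod.cong simp: inner_sum_left inner_Basis if_distrib sum.If_cases cong: if_cong)
  finally show ?thesis
    by (simp add: PiM_std_normal)
qed

text \<open>The linear map carrying the standard basis to \<open>e\<close> is orthogonal, so the
  Gaussian law does not notice it. Indices are natural numbers so that blocks of coordinates become
  intervals, as in \<open>F_distribution\<close>.\<close>

lemma std_gaussian_eq_distr_orthonormal:
  fixes e :: "nat \<Rightarrow> real ^ 'n"
  assumes e: "\<And>i j. i < CARD('n) \<Longrightarrow> j < CARD('n) \<Longrightarrow> e i \<bullet> e j = (if i = j then 1 else 0)"
  shows "std_gaussian
    = distr (PiM {..<CARD('n)} (\<lambda>_. std_normal)) borel (\<lambda>z. \<Sum>i<CARD('n). z i *\<^sub>R e i)"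
proof -
  let ?n = "CARD('n)"
  obtain b :: "nat \<Rightarrow> real ^ 'n" where b: "bij_betw b {..<?n} Basis"
    using ex_bij_betw_nat_finite[of "Basis :: (real ^ 'n) set"] by (auto simp: atLeast0LessThan)
  define T where "T x = (\<Sum>i<?n. (x \<bullet> b i) *\<^sub>R e i)" for x
  have bb: "b i \<bullet> b j = (if i = j then 1 else 0)" if "i < ?n" "j < ?n" for i j
  proof -
    have "b i \<in> Basis" "b j \<in> Basis" "b i = b j \<longleftrightarrow> i = j"
      using that b by (auto simp: bij_betw_def inj_on_def)
    then show ?thesis by (simp add: inner_Basis)
  qed
  have lin: "linear T"
    unfolding T_def by (intro linearI)
      (simp_all add: inner_add_left scaleR_add_left sum.distrib scaleR_sum_right)
  have "T x \<bullet> T y = x \<bullet> y" for x y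
  proof -
    have "T x \<bullet> T y = (\<Sum>j<?n. \<Sum>i<?n. (x \<bullet> b i) * (y \<bullet> b j) * (e i \<bullet> e j))"
      by (simp add: T_def inner_sum_left inner_sum_right sum_distrib_left mult_ac)
    also have "\<dots> = (\<Sum>i<?n. (x \<bullet> b i) * (y \<bullet> b i))"
    proof (intro sum.cong refl)
      fix j assume "j \<in> {..<?n}"
      then have "(\<Sum>i<?n. (x \<bullet> b i) * (y \<bullet> b j) * (e i \<bullet> e j))
          = (\<Sum>i<?n. if i = j then (x \<bullet> b i) * (y \<bullet> b j) else 0)"
        by (intro sum.cong refl) (simp add: e)
      with \<open>j \<in> {..<?n}\<close> show "(\<Sum>i<?n. (x \<bullet> b i) * (y \<bullet> b j) * (e i \<bullet> e j)) = (x \<bullet> b j) * (y \<bullet> b j)"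
        by simp
    qed
    also have "\<dots> = (\<Sum>v\<in>Basis. (x \<bullet> v) * (y \<bullet> v))"
      by (rule sum.reindex_bij_betw[OF b])
    finally show ?thesis by (simp add: euclidean_inner[of x y])
  qed
  with lin have T: "orthogonal_transformation T"
    by (simp add: orthogonal_transformation_def)
  have [measurable]: "T \<in> borel_measurable borel"
    using lin by (rule borel_measurable_linear)
  let ?P = "PiM {..<?n} (\<lambda>_. std_normal)" and ?Q = "PiM Basis (\<lambda>_. std_normal)"
  let ?t = "\<lambda>\<omega> :: real ^ 'n \<Rightarrow> real. \<lambda>k\<in>{..<?n}. \<omega> (b k)"
  have P: "?P = distr ?Q ?P ?t"
    using b by (intro distr_PiM_reindex[symmetric] prob_space_std_normal) (auto simp: bij_betw_def)
  have mt: "?t \<in> measurable ?Q ?P"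
    using b by (intro measurable_restrict measurable_component_singleton) (auto simp: bij_betw_def)
  have "distr ?P borel (\<lambda>z. \<Sum>i<?n. z i *\<^sub>R e i) = distr ?Q borel (\<lambda>f. \<Sum>i<?n. f (b i) *\<^sub>R e i)"
    by (subst P, subst distr_distr[OF _ mt]) (auto simp: comp_def intro!: distr_cong)
  also have "\<dots> = distr ?Q borel (\<lambda>f. T (\<Sum>v\<in>Basis. f v *\<^sub>R v))"
  proof (intro distr_cong refl)
    fix f :: "real ^ 'n \<Rightarrow> real"
    have "(\<Sum>v\<in>Basis. f v *\<^sub>R v) = (\<Sum>i<?n. f (b i) *\<^sub>R b i)"
      by (rule sum.reindex_bij_betw[OF b, symmetric])
    moreover have "(\<Sum>i<?n. f (b i) *\<^sub>R b i) \<bullet> b j = f (b j)" if "j < ?n" for j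
    proof -
      have "(\<Sum>i<?n. f (b i) *\<^sub>R b i) \<bullet> b j = (\<Sum>i<?n. if i = j then f (b j) else 0)"
        unfolding inner_sum_left using that by (intro sum.cong refl) (simp add: bb)
      then show ?thesis
        using that by simp
    qed
    ultimately show "(\<Sum>i<?n. f (b i) *\<^sub>R e i) = T (\<Sum>v\<in>Basis. f v *\<^sub>R v)"
      by (simp add: T_def)
  qed
  also have "\<dots> = distr (distr ?Q borel (\<lambda>f. \<Sum>v\<in>Basis. f v *\<^sub>R v)) borel T"
    by (subst distr_distr) (auto simp: comp_def)
  finally show ?thesis
    using std_gaussian_distr_orthogonal[OF T] by (simp add: std_gaussian_eq_distr_Basis[symmetric])
qed

section \<open>Independence of norm and direction\<close>

lemma norm_orthonormal_sum:
  fixes e :: "'i \<Rightarrow> 'v::real_inner"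
  assumes "finite J" "\<And>i j. i \<in> J \<Longrightarrow> j \<in> J \<Longrightarrow> e i \<bullet> e j = (if i = j then 1 else 0)"
  shows "(norm (\<Sum>i\<in>J. z i *\<^sub>R e i))\<^sup>2 = (\<Sum>i\<in>J. (z i)\<^sup>2)"
proof -
  have "(norm (\<Sum>i\<in>J. z i *\<^sub>R e i))\<^sup>2 = (\<Sum>i\<in>J. \<Sum>j\<in>J. if j = i then z i * z i else 0)"
    unfolding power2_norm_eq_inner inner_sum_left inner_sum_right
    by (intro sum.cong refl) (simp add: assms)
  then show ?thesis
    using assms by (simp add: power2_eq_square)
qed

text \<open>Each coordinate contributes one factor \<open>r\<close> by the one-dimensional scaling
  rule, and boxes determine the product. This is the homogeneity that makes cones scale.\<close>

lemma PiM_lborel_scale: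
  fixes r :: real
  assumes J: "finite J" and r: "r > 0"
  shows "PiM J (\<lambda>_. lborel) = density (distr (PiM J (\<lambda>_. lborel)) (PiM J (\<lambda>_. lborel)) (\<lambda>z. \<lambda>i\<in>J. r * z i))
      (\<lambda>_. ennreal (r ^ card J))"
proof -
  interpret L: product_sigma_finite "\<lambda>_ :: 'a. lborel :: real measure" ..
  let ?L = "PiM J (\<lambda>_. lborel :: real measure)"
  let ?s = "\<lambda>z :: 'a \<Rightarrow> real. \<lambda>i\<in>J. r * z i"
  have [measurable]: "?s \<in> measurable ?L ?L"
    by (intro measurable_restrict) auto
  have "density (distr ?L ?L ?s) (\<lambda>_. ennreal (r ^ card J)) = ?L"
  proof (rule L.PiM_eqI[OF J])
    show "sets (density (distr ?L ?L ?s) (\<lambda>_. ennreal (r ^ card J))) = sets ?L" by simp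
    fix A :: "'a \<Rightarrow> real set" assume A: "\<And>i. i \<in> J \<Longrightarrow> A i \<in> sets lborel"
    have PA: "Pi\<^sub>E J A \<in> sets ?L"
      using A J by (intro sets_PiM_I_finite) auto
    have sA: "(\<lambda>x. r * x) -` A i \<in> sets borel" if "i \<in> J" for i
      using measurable_sets[of "\<lambda>x. r * x" borel borel "A i"] A[OF that] by simp
    have "emeasure (density (distr ?L ?L ?s) (\<lambda>_. ennreal (r ^ card J))) (Pi\<^sub>E J A)
        = ennreal (r ^ card J) * emeasure (distr ?L ?L ?s) (Pi\<^sub>E J A)"
      using PA by (simp add: emeasure_density_const)
    also have "emeasure (distr ?L ?L ?s) (Pi\<^sub>E J A) = emeasure ?L (?s -` Pi\<^sub>E J A \<inter> space ?L)"
      using PA by (intro emeasure_distr) auto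
    also have "?s -` Pi\<^sub>E J A \<inter> space ?L = Pi\<^sub>E J (\<lambda>i. (\<lambda>x. r * x) -` A i)"
      by (auto simp: space_PiM PiE_iff)
    also have "emeasure ?L \<dots> = (\<Prod>i\<in>J. emeasure lborel ((\<lambda>x. r * x) -` A i))"
      using J sA by (intro L.emeasure_PiM) auto
    also have "ennreal (r ^ card J) * \<dots> = (\<Prod>i\<in>J. ennreal r * emeasure lborel ((\<lambda>x. r * x) -` A i))"
      using r by (simp add: prod.distrib ennreal_power)
    also have "\<dots> = (\<Prod>i\<in>J. emeasure lborel (A i))"
    proof (intro prod.cong refl)
      fix i assume i: "i \<in> J"
      have "emeasure lborel (A i) = emeasure (density (distr lborel borel (\<lambda>x. 0 + r * x)) (\<lambda>_. ennreal \<bar>r\<bar>)) (A i)"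
        using lborel_real_affine[of r 0] r by simp
      also have "\<dots> = ennreal r * emeasure lborel ((\<lambda>x. r * x) -` A i)"
        using A[OF i] r by (simp add: emeasure_density_const emeasure_distr)
      finally show "ennreal r * emeasure lborel ((\<lambda>x. r * x) -` A i) = emeasure lborel (A i)" ..
    qed
    finally show "emeasure (density (distr ?L ?L ?s) (\<lambda>_. ennreal (r ^ card J))) (Pi\<^sub>E J A)
        = (\<Prod>i\<in>J. emeasure lborel (A i))" .
  qed
  then show ?thesis ..
qed

text \<open>
  Lebesgue measure is homogeneous, so on each cone it charges the radial balls proportionally; the
  Gaussian density depends on the radius only.
\<close>

lemma std_normal_norm_direction_indep:
  fixes e :: "'i \<Rightarrow> 'v::euclidean_space"
  assumes J: "finite J" "J \<noteq> {}"
    and e: "\<And>i j. i \<in> J \<Longrightarrow> j \<in> J \<Longrightarrow> e i \<bullet> e j = (if i = j then 1 else 0)"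
  defines "l \<equiv> \<lambda>z. \<Sum>i\<in>J. z i *\<^sub>R e i"
  defines "P \<equiv> PiM J (\<lambda>_. std_normal)"
  shows "distr P (borel \<Otimes>\<^sub>M borel) (\<lambda>z. (norm (l z), l z /\<^sub>R norm (l z)))
    = distr P borel (\<lambda>z. norm (l z)) \<Otimes>\<^sub>M distr P borel (\<lambda>z. l z /\<^sub>R norm (l z))"
proof -
  interpret L: product_sigma_finite "\<lambda>_ :: 'i. lborel :: real measure" ..
  interpret P: prob_space P
    unfolding P_def by (intro prob_space_PiM prob_space_std_normal)
  define L where "L = PiM J (\<lambda>_. lborel :: real measure)"
  have P_sets [measurable_cong]: "sets P = sets L"
    unfolding P_def L_def by (intro sets_PiM_cong) auto
  have spL: "space L = extensional J"
    by (auto simp: L_def space_PiM PiE_def)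
  have [measurable]: "l \<in> borel_measurable L"
    unfolding l_def L_def by measurable
  have norm_l: "(norm (l z))\<^sup>2 = (\<Sum>i\<in>J. (z i)\<^sup>2)" for z
    unfolding l_def by (rule norm_orthonormal_sum) (use J e in auto)
  define g :: "real \<Rightarrow> ennreal"
    where "g x = ennreal ((1 / sqrt (2 * pi)) ^ card J * exp (- x\<^sup>2 / 2))" for x
  have [measurable]: "g \<in> borel_measurable borel"
    unfolding g_def by measurable
  have P_dens: "P = density L (\<lambda>z. g (norm (l z)))"
  proof -
    have "(\<Prod>i\<in>J. std_normal_density (z i)) = (1 / sqrt (2 * pi)) ^ card J * exp (- (norm (l z))\<^sup>2 / 2)" for z
      using J by (simp add: std_normal_density_def prod.distrib power_divide exp_sum[symmetric] sum_negf
          sum_divide_distrib[symmetric] norm_l prod_dividef)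
    then show ?thesis
      using J by (simp add: P_def L_def PiM_std_normal g_def)
  qed
  have space_P: "space P = space L"
    by (simp add: P_dens)
  have emeasure_P: "emeasure P S = (\<integral>\<^sup>+z. g (norm (l z)) * indicator S z \<partial>L)" if "S \<in> sets L" for S
    unfolding P_dens using that by (subst emeasure_density) auto
  let ?D = "\<lambda>z. l z /\<^sub>R norm (l z)"
  let ?s = "\<lambda>r :: real. \<lambda>z. \<lambda>i\<in>J. r * z i"
  have l_s: "l (?s r z) = r *\<^sub>R l z" for r z
    by (simp add: l_def scaleR_sum_right)
  have D_s: "?D (?s r z) = ?D z" if "r > 0" for r z
    using that by (simp add: l_s)
  \<comment> \<open>The volume of the part of the unit ball seen in the directions \<open>A\<close>.
    The quotient of \<open>K A\<close> by \<open>K UNIV\<close> will turn out to be the probability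
    that the direction lies in \<open>A\<close>.\<close>
  define K where "K A = emeasure L {z \<in> space L. norm (l z) \<le> 1 \<and> ?D z \<in> A}" for A
  have cone: "emeasure L {z \<in> space L. norm (l z) \<le> r \<and> ?D z \<in> A} = ennreal (r ^ card J) * K A"
    if [measurable]: "A \<in> sets borel" and r: "r > 0" for A r
  proof -
    let ?C = "{z \<in> space L. norm (l z) \<le> r \<and> ?D z \<in> A}"
    have C: "?C \<in> sets L" by measurable
    have [measurable]: "?s r \<in> measurable L L"
      unfolding L_def by (intro measurable_restrict) auto
    have "emeasure L ?C = emeasure (density (distr L L (?s r)) (\<lambda>_. ennreal (r ^ card J))) ?C"
      using PiM_lborel_scale[OF J(1) r] by (simp add: L_def)
    also have "\<dots> = ennreal (r ^ card J) * emeasure (distr L L (?s r)) ?C"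
      using C by (simp add: emeasure_density_const)
    also have "emeasure (distr L L (?s r)) ?C = emeasure L (?s r -` ?C \<inter> space L)"
      using C by (intro emeasure_distr) auto
    also have "?s r -` ?C \<inter> space L = {z \<in> space L. norm (l z) \<le> 1 \<and> ?D z \<in> A}"
      using r D_s[OF r] by (auto simp: l_s spL simp del: scaleR_scaleR)
    finally show ?thesis by (simp add: K_def)
  qed
  \<comment> \<open>Scaling by a positive \<open>r\<close> says nothing about the origin, where the
    direction takes the default value 0. The origin is null because \<open>J\<close> is
    nonempty.\<close>
  have apex: "emeasure L {z \<in> space L. norm (l z) \<le> 0 \<and> ?D z \<in> A} = 0" for A
  proof -
    have "{z \<in> space L. norm (l z) \<le> 0 \<and> ?D z \<in> A} \<subseteq> Pi\<^sub>E J (\<lambda>_. {0})"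
    proof
      fix z assume "z \<in> {z \<in> space L. norm (l z) \<le> 0 \<and> ?D z \<in> A}"
      then have z: "z \<in> space L" "norm (l z) \<le> 0" by auto
      then have "(\<Sum>i\<in>J. (z i)\<^sup>2) = 0" using norm_l[of z] by simp
      then show "z \<in> Pi\<^sub>E J (\<lambda>_. {0})"
        using z J by (intro PiE_I) (auto simp: sum_nonneg_eq_0_iff spL extensional_def)
    qed
    moreover have "Pi\<^sub>E J (\<lambda>_. {0}) \<in> sets L"
      using J unfolding L_def by (intro sets_PiM_I_finite) auto
    moreover have "emeasure L (Pi\<^sub>E J (\<lambda>_. {0})) = (\<Prod>i\<in>J. emeasure lborel {0 :: real})"
      unfolding L_def by (rule L.emeasure_PiM) (use J in auto)
    then have "emeasure L (Pi\<^sub>E J (\<lambda>_. {0})) = 0"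
      using J by (simp add: card_gt_0_iff del: PiE_singleton)
    ultimately show ?thesis
      by (rule emeasure_eq_0[rotated 2])
  qed
  have z_le: "\<bar>z i\<bar> \<le> norm (l z)" if "i \<in> J" for z i
  proof -
    have "(z i)\<^sup>2 \<le> (\<Sum>i\<in>J. (z i)\<^sup>2)"
      using that J by (intro member_le_sum) auto
    then show ?thesis
      using norm_l[of z] abs_le_square_iff[of "z i" "norm (l z)"] by simp
  qed
  \<comment> \<open>\<open>K UNIV\<close> is cancelled at the end, so it must be finite and nonzero.
    The unit ball lies in a cube.\<close>
  have K_UNIV_fin: "K UNIV < \<infinity>"
  proof -
    have "K UNIV \<le> emeasure L (Pi\<^sub>E J (\<lambda>_. {-1..1}))"
      unfolding K_def
    proof (rule emeasure_mono)
      show "{z \<in> space L. norm (l z) \<le> 1 \<and> ?D z \<in> UNIV} \<subseteq> Pi\<^sub>E J (\<lambda>_. {-1..1})"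
      proof
        fix z assume "z \<in> {z \<in> space L. norm (l z) \<le> 1 \<and> ?D z \<in> UNIV}"
        then have z: "z \<in> space L" "norm (l z) \<le> 1" by auto
        have "\<bar>z i\<bar> \<le> 1" if "i \<in> J" for i
          using z_le[OF that, of z] z by linarith
        then show "z \<in> Pi\<^sub>E J (\<lambda>_. {-1..1})"
          using z by (auto simp: spL PiE_iff abs_le_iff)
      qed
      show "Pi\<^sub>E J (\<lambda>_. {-1..1}) \<in> sets L"
        using J unfolding L_def by (intro sets_PiM_I_finite) auto
    qed
    also have "\<dots> < \<infinity>"
      using J by (simp add: L_def L.emeasure_PiM ennreal_power[symmetric] power_less_top_ennreal)
    finally show ?thesis .
  qed
  \<comment> \<open>If the unit ball were null, so would be all its multiples and with them the
    whole space, although \<open>P\<close> has mass 1 and a density.\<close>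
  have K_UNIV_pos: "K UNIV \<noteq> 0"
  proof
    assume 0: "K UNIV = 0"
    have "emeasure L (space L) = emeasure L (\<Union>k::nat. {z \<in> space L. norm (l z) \<le> real (Suc k) \<and> ?D z \<in> UNIV})"
    proof (intro arg_cong[of _ _ "emeasure L"] set_eqI iffI)
      fix z assume "z \<in> space L"
      moreover obtain k :: nat where "norm (l z) \<le> real k"
        using real_arch_simple by blast
      then have "norm (l z) \<le> real (Suc k)" by simp
      ultimately show "z \<in> (\<Union>k::nat. {z \<in> space L. norm (l z) \<le> real (Suc k) \<and> ?D z \<in> UNIV})"
        by blast
    qed blast
    also have "\<dots> = 0"
    proof (rule emeasure_UN_eq_0)
      show "emeasure L {z \<in> space L. norm (l z) \<le> real (Suc k) \<and> ?D z \<in> UNIV} = 0" for k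
        using cone[of UNIV "real (Suc k)"] 0 by simp
      show "range (\<lambda>k. {z \<in> space L. norm (l z) \<le> real (Suc k) \<and> ?D z \<in> UNIV}) \<subseteq> sets L"
        by (intro image_subsetI) measurable
    qed
    finally have null: "space L \<in> null_sets L"
      by (intro null_setsI) auto
    have "emeasure P (space L) = (\<integral>\<^sup>+z. g (norm (l z)) * indicator (space L) z \<partial>L)"
      by (rule emeasure_P) simp
    also have "\<dots> = 0"
      by (rule nn_integral_null_set[OF null])
    finally have "emeasure P (space L) = 0" .
    then show False
      using P.emeasure_space_1 by (simp add: space_P)
  qed
  have prod: "K UNIV * emeasure P {z \<in> space P. norm (l z) \<in> B \<and> ?D z \<in> A}
      = K A * emeasure P {z \<in> space P. norm (l z) \<in> B}"
    if [measurable]: "A \<in> sets borel" "B \<in> sets borel" for A B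
  proof -
    \<comment> \<open>Radial image measures of the cone over \<open>A\<close> and of the whole
      space, weighted crosswise. Both give \<open>{..r}\<close> the mass
      \<open>r ^ card J * K UNIV * K A\<close> for positive \<open>r\<close>.\<close>
    let ?\<nu>1 = "distr (density L (\<lambda>z. K UNIV * indicator {z \<in> space L. ?D z \<in> A} z)) borel (\<lambda>z. norm (l z))"
    let ?\<nu>2 = "distr (density L (\<lambda>z. K A)) borel (\<lambda>z. norm (l z))"
    have e1: "emeasure ?\<nu>1 {..r} = K UNIV * emeasure L {z \<in> space L. norm (l z) \<le> r \<and> ?D z \<in> A}" for r
    proof -
      have "emeasure ?\<nu>1 {..r} = (\<integral>\<^sup>+z. K UNIV * indicator {z \<in> space L. norm (l z) \<le> r \<and> ?D z \<in> A} z \<partial>L)"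
        by (simp add: emeasure_distr emeasure_density) (auto intro!: nn_integral_cong simp: indicator_def)
      then show ?thesis
        by (simp add: nn_integral_cmult_indicator)
    qed
    have e2: "emeasure ?\<nu>2 {..r} = K A * emeasure L {z \<in> space L. norm (l z) \<le> r \<and> ?D z \<in> UNIV}" for r
    proof -
      have "emeasure ?\<nu>2 {..r} = (\<integral>\<^sup>+z. K A * indicator {z \<in> space L. norm (l z) \<le> r \<and> ?D z \<in> UNIV} z \<partial>L)"
        by (simp add: emeasure_distr emeasure_density) (auto intro!: nn_integral_cong simp: indicator_def)
      then show ?thesis
        by (simp add: nn_integral_cmult_indicator)
    qed
    have "K A \<le> K UNIV"
      unfolding K_def by (intro emeasure_mono) auto
    then have K_fin: "K A < \<infinity>"
      using K_UNIV_fin by (rule le_less_trans)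
    have "?\<nu>1 = ?\<nu>2"
    proof (rule measure_eqI_generator_eq[where E = "range atMost" and A = "\<lambda>k::nat. {..real k}" and \<Omega> = UNIV])
      show "Int_stable (range atMost :: real set set)"
        by (auto simp: Int_stable_def)
      show "sets ?\<nu>1 = sigma_sets UNIV (range atMost)" "sets ?\<nu>2 = sigma_sets UNIV (range atMost)"
        by (simp_all add: borel_eq_atMost)
      show "(\<Union>k::nat. {..real k}) = UNIV"
        by (auto intro: real_arch_simple)
      have eq: "emeasure ?\<nu>1 {..r} = emeasure ?\<nu>2 {..r}" for r
      proof (cases r "0::real" rule: linorder_cases)
        case less
        then have "\<not> norm (l z) \<le> r" for z
          using norm_ge_zero[of "l z"] by linarith
        then show ?thesis unfolding e1 e2 by simp
      next
        case equal
        then show ?thesis unfolding e1 e2 using apex[of A] apex[of UNIV] by simp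
      next
        case greater
        then show ?thesis unfolding e1 e2 by (simp add: cone cone[of UNIV, simplified] mult_ac)
      qed
      show "emeasure ?\<nu>1 X = emeasure ?\<nu>2 X" if "X \<in> range atMost" for X
        using that eq by auto
      show "emeasure ?\<nu>1 {..real k} \<noteq> \<infinity>" for k
      proof -
        have "emeasure L {z \<in> space L. norm (l z) \<le> real k \<and> ?D z \<in> UNIV} < \<infinity>"
          using K_UNIV_fin cone[of UNIV "real k"] apex[of UNIV]
          by (cases "k = 0") (auto simp: ennreal_mult_less_top)
        then show ?thesis
          unfolding eq e2 using K_fin by (auto simp: ennreal_mult_eq_top_iff)
      qed
    qed auto
    \<comment> \<open>The Gaussian density is a function \<open>g\<close> of the radius alone, so
      integrating it against the two equal radial measures passes from Lebesgue measure to
      \<open>P\<close>.\<close>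
    then have "(\<integral>\<^sup>+x. g x * indicator B x \<partial>?\<nu>1) = (\<integral>\<^sup>+x. g x * indicator B x \<partial>?\<nu>2)"
      by simp
    moreover have "(\<integral>\<^sup>+x. g x * indicator B x \<partial>?\<nu>1)
        = K UNIV * emeasure P {z \<in> space P. norm (l z) \<in> B \<and> ?D z \<in> A}"
    proof -
      have "(\<integral>\<^sup>+x. g x * indicator B x \<partial>?\<nu>1)
        = (\<integral>\<^sup>+z. K UNIV * (g (norm (l z)) * indicator {z \<in> space P. norm (l z) \<in> B \<and> ?D z \<in> A} z) \<partial>L)"
        by (simp add: nn_integral_distr nn_integral_density)
           (auto intro!: nn_integral_cong simp: indicator_def mult_ac space_P)
      also have "\<dots> = K UNIV * emeasure P {z \<in> space P. norm (l z) \<in> B \<and> ?D z \<in> A}"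
      proof -
        have "{z \<in> space P. norm (l z) \<in> B \<and> ?D z \<in> A} \<in> sets L"
          unfolding space_P by measurable
        then show ?thesis
          by (simp add: nn_integral_cmult emeasure_P)
      qed
      finally show ?thesis .
    qed
    moreover have "(\<integral>\<^sup>+x. g x * indicator B x \<partial>?\<nu>2) = K A * emeasure P {z \<in> space P. norm (l z) \<in> B}"
    proof -
      have "(\<integral>\<^sup>+x. g x * indicator B x \<partial>?\<nu>2)
        = (\<integral>\<^sup>+z. K A * (g (norm (l z)) * indicator {z \<in> space P. norm (l z) \<in> B} z) \<partial>L)"
        by (simp add: nn_integral_distr nn_integral_density)
           (auto intro!: nn_integral_cong simp: indicator_def mult_ac space_P)
      also have "\<dots> = K A * emeasure P {z \<in> space P. norm (l z) \<in> B}"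
      proof -
        have "{z \<in> space P. norm (l z) \<in> B} \<in> sets L"
          unfolding space_P by measurable
        then show ?thesis
          by (simp add: nn_integral_cmult emeasure_P)
      qed
      finally show ?thesis .
    qed
    ultimately show ?thesis by simp
  qed
  have indep: "emeasure P {z \<in> space P. norm (l z) \<in> B \<and> ?D z \<in> A}
      = emeasure P {z \<in> space P. norm (l z) \<in> B} * emeasure P {z \<in> space P. ?D z \<in> A}"
    if AB: "A \<in> sets borel" "B \<in> sets borel" for A B
  proof -
    have "K A = K UNIV * emeasure P {z \<in> space P. ?D z \<in> A}"
      using prod[OF AB(1), of UNIV] P.emeasure_space_1 by simp
    with prod[OF AB] have "K UNIV * emeasure P {z \<in> space P. norm (l z) \<in> B \<and> ?D z \<in> A}
      = K UNIV * (emeasure P {z \<in> space P. norm (l z) \<in> B} * emeasure P {z \<in> space P. ?D z \<in> A})"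
      by (simp add: mult_ac)
    then show ?thesis
      using K_UNIV_pos K_UNIV_fin by (auto simp: ennreal_mult_cancel_left)
  qed
  let ?N = "\<lambda>z. norm (l z)"
  interpret N: prob_space "distr P borel ?N" by (rule P.prob_space_distr) measurable
  interpret D: prob_space "distr P borel ?D" by (rule P.prob_space_distr) measurable
  show ?thesis
  proof (rule pair_measure_eqI[symmetric])
    fix B :: "real set" and A :: "'v set"
    assume "B \<in> sets (distr P borel ?N)" "A \<in> sets (distr P borel ?D)"
    then have [measurable]: "B \<in> sets borel" "A \<in> sets borel" by auto
    have "emeasure (distr P (borel \<Otimes>\<^sub>M borel) (\<lambda>z. (?N z, ?D z))) (B \<times> A)
        = emeasure P {z \<in> space P. ?N z \<in> B \<and> ?D z \<in> A}"
      by (subst emeasure_distr) (auto intro!: arg_cong2[where f = emeasure])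
    moreover have "emeasure (distr P borel ?N) B = emeasure P {z \<in> space P. ?N z \<in> B}"
      by (subst emeasure_distr) (auto intro!: arg_cong2[where f = emeasure])
    moreover have "emeasure (distr P borel ?D) A = emeasure P {z \<in> space P. ?D z \<in> A}"
      by (subst emeasure_distr) (auto intro!: arg_cong2[where f = emeasure])
    ultimately show "emeasure (distr P borel ?N) B * emeasure (distr P borel ?D) A
        = emeasure (distr P (borel \<Otimes>\<^sub>M borel) (\<lambda>z. (?N z, ?D z))) (B \<times> A)"
      using indep[of A B] by simp
  qed (auto intro: N.sigma_finite_measure_axioms D.sigma_finite_measure_axioms)
qed

section \<open>Projections onto column spans\<close>

lemma subspace_column_span [simp]: "subspace (column_span X \<tau>)"
  by (simp add: column_span_def)

lemma proj_mat_in_column_span: "proj_mat X \<tau> *v y \<in> column_span X \<tau>"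
  and orthogonal_proj_mat: "z \<in> column_span X \<tau> \<Longrightarrow> orthogonal (y - proj_mat X \<tau> *v y) z"
  using is_orth_proj_proj_mat[of X \<tau>] by (auto simp: is_orth_proj_def)

lemma resid_eq: "resid X \<tau> y = y - proj_mat X \<tau> *v y"
  by (simp add: resid_def matrix_vector_mult_diff_rdistrib)

lemma linear_resid: "linear (resid X \<tau>)"
  unfolding resid_def[abs_def] by (rule matrix_vector_mul_linear)

lemma proj_mat_unique:
  assumes "h \<in> column_span X \<tau>" "\<And>z. z \<in> column_span X \<tau> \<Longrightarrow> orthogonal (y - h) z"
  shows "proj_mat X \<tau> *v y = h"
  by (rule orth_proj_point_unique[of "column_span X \<tau>" _ _ y])
     (use assms proj_mat_in_column_span orthogonal_proj_mat in auto)

lemma proj_mat_id: "y \<in> column_span X \<tau> \<Longrightarrow> proj_mat X \<tau> *v y = y"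
  by (rule proj_mat_unique) (auto simp: orthogonal_def)

lemma resid_eq_0_iff: "resid X \<tau> y = 0 \<longleftrightarrow> y \<in> column_span X \<tau>"
  using proj_mat_id[of y X \<tau>] proj_mat_in_column_span[of X \<tau> y] by (auto simp: resid_eq)

lemma inner_proj_mat_resid: "(proj_mat X \<tau> *v y) \<bullet> resid X \<tau> y = 0"
  using orthogonal_proj_mat[OF proj_mat_in_column_span[of X \<tau> y], of y]
  by (simp add: resid_eq orthogonal_def inner_commute)

lemma inner_proj_mat_self: "y \<bullet> (proj_mat X \<tau> *v y) = (norm (proj_mat X \<tau> *v y))\<^sup>2"
  using inner_proj_mat_resid[of X \<tau> y]
  by (simp add: resid_eq power2_norm_eq_inner inner_diff_right inner_commute)

lemma inner_resid_self: "y \<bullet> resid X \<tau> y = (norm (resid X \<tau> y))\<^sup>2"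
  using inner_proj_mat_resid[of X \<tau> y]
  by (simp add: resid_eq power2_norm_eq_inner inner_diff_left inner_diff_right inner_commute)

lemma norm_resid_le: "norm (resid X \<tau> y) \<le> norm y"
proof (rule power2_le_imp_le)
  have "y = proj_mat X \<tau> *v y + resid X \<tau> y"
    by (simp add: resid_eq)
  then have "(norm y)\<^sup>2 = (norm (proj_mat X \<tau> *v y))\<^sup>2 + (norm (resid X \<tau> y))\<^sup>2"
    using norm_add_Pythagorean inner_proj_mat_resid[of X \<tau> y] by (metis orthogonal_def)
  then show "(norm (resid X \<tau> y))\<^sup>2 \<le> (norm y)\<^sup>2" by simp
qed simp

lemma subspace_coeff_space: "subspace (coeff_space \<tau>)"
  by (auto simp: subspace_def coeff_space_def)

lemma linear_model_mean: "linear (model_mean X \<tau>)"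
  unfolding model_mean_def
  by (intro linearI) (simp_all add: scaleR_add_left sum.distrib scaleR_sum_right)

lemma column_span_eq_image_model_mean: "column_span X \<tau> = model_mean X \<tau> ` coeff_space \<tau>"
proof
  show "column_span X \<tau> \<subseteq> model_mean X \<tau> ` coeff_space \<tau>"
    unfolding column_span_def
  proof (rule span_minimal)
    show "subspace (model_mean X \<tau> ` coeff_space \<tau>)"
      by (intro linear_subspace_image linear_model_mean subspace_coeff_space)
    show "(\<lambda>j. column j X) ` \<tau> \<subseteq> model_mean X \<tau> ` coeff_space \<tau>"
    proof safe
      fix j assume j: "j \<in> \<tau>"
      have "model_mean X \<tau> (axis j 1) = (\<Sum>i\<in>\<tau>. if i = j then column j X else 0)"
        unfolding model_mean_def by (intro sum.cong) (auto simp: axis_def)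
      then have "model_mean X \<tau> (axis j 1) = column j X"
        using j by simp
      moreover have "axis j 1 \<in> coeff_space \<tau>"
        using j by (auto simp: coeff_space_def axis_def)
      ultimately show "column j X \<in> model_mean X \<tau> ` coeff_space \<tau>"
        by (metis imageI)
    qed
  qed
  show "model_mean X \<tau> ` coeff_space \<tau> \<subseteq> column_span X \<tau>"
    unfolding column_span_def model_mean_def
    by (auto intro!: span_sum span_scale intro: span_base)
qed

lemma model_mean_in_column_span: "model_mean X \<tau> \<beta> \<in> column_span X \<tau>"
  unfolding column_span_def model_mean_def by (auto intro!: span_sum span_scale intro: span_base)

lemma resid_model_mean [simp]: "resid X \<tau> (model_mean X \<tau> \<beta>) = 0"
  by (simp add: resid_eq_0_iff model_mean_in_column_span)

text \<open>Such a model would also represent the true mean with the least number of columns,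
  against uniqueness of the minimizer.\<close>

lemma identifiable_not_in_column_span:
  fixes X :: "real ^ 'p ^ 'n"
  assumes "identifiable X \<tau>0 \<beta>0" "\<tau> \<noteq> \<tau>0" "card \<tau> \<le> card \<tau>0"
  shows "model_mean X \<tau>0 \<beta>0 \<notin> column_span X \<tau>"
proof
  let ?P = "\<lambda>\<tau>. \<exists>\<beta>\<in>coeff_space \<tau>. model_mean X \<tau> \<beta> = model_mean X \<tau>0 \<beta>0"
  assume "model_mean X \<tau>0 \<beta>0 \<in> column_span X \<tau>"
  then have "?P \<tau>"
    by (auto simp: column_span_eq_image_model_mean)
  moreover have "is_arg_min card ?P \<tau>0"
    using assms(1) by (auto simp: identifiable_def)
  ultimately have "is_arg_min card ?P \<tau>"
    using assms(3) by (auto simp: is_arg_min_def)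
  then show False
    using assms(1,2) by (auto simp: identifiable_def)
qed

text \<open>Were the columns dependent, a basis selected among them would come from a smaller model
  with the same span, hence still containing the true mean. The rank of the projection thus agrees
  with the column count in the degrees of freedom of the statistic.\<close>

lemma identifiable_dim_column_span:
  fixes X :: "real ^ 'p ^ 'n"
  assumes "identifiable X \<tau>0 \<beta>0"
  shows "dim (column_span X \<tau>0) = card \<tau>0"
proof (rule antisym)
  let ?c = "\<lambda>j. column j X"
  have "dim (?c ` \<tau>0) \<le> card (?c ` \<tau>0)"
    by (rule dim_le_card') simp
  also have "\<dots> \<le> card \<tau>0"
    by (rule card_image_le) simp
  finally show "dim (column_span X \<tau>0) \<le> card \<tau>0"
    by (simp add: column_span_def)
  obtain B where B: "B \<subseteq> ?c ` \<tau>0" "independent B" "?c ` \<tau>0 \<subseteq> span B" "card B = dim (?c ` \<tau>0)"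
    using basis_exists by blast
  \<comment> \<open>One index is selected per basis vector, as distinct indices may carry equal
    columns.\<close>
  then obtain \<tau> where \<tau>: "\<tau> \<subseteq> \<tau>0" "inj_on ?c \<tau>" "B = ?c ` \<tau>"
    by (meson subset_image_inj)
  have "column_span X \<tau>0 \<subseteq> column_span X \<tau>"
    using B(3) \<tau>(3) by (simp add: column_span_def span_minimal)
  then have "model_mean X \<tau>0 \<beta>0 \<in> column_span X \<tau>"
    using model_mean_in_column_span by blast
  then have "\<tau> = \<tau>0 \<or> card \<tau>0 \<le> card \<tau>"
    using identifiable_not_in_column_span[OF assms, of \<tau>] by linarith
  moreover have "card \<tau> = dim (column_span X \<tau>0)"
    using \<tau> B by (simp add: card_image column_span_def)
  ultimately show "card \<tau>0 \<le> dim (column_span X \<tau>0)" by auto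
qed

text \<open>Orthonormal bases of \<open>S\<close> and of its orthogonal complement are listed one
  after the other; their sizes add up to the dimension of the space.\<close>

lemma orthonormal_basis_extending_subspace:
  fixes S :: "(real ^ 'n) set"
  assumes S: "subspace S"
  obtains e :: "nat \<Rightarrow> real ^ 'n"
  where "\<And>i j. i < CARD('n) \<Longrightarrow> j < CARD('n) \<Longrightarrow> e i \<bullet> e j = (if i = j then 1 else 0)"
    and "\<And>i. i < dim S \<Longrightarrow> e i \<in> S"
    and "\<And>i z. dim S \<le> i \<Longrightarrow> i < CARD('n) \<Longrightarrow> z \<in> S \<Longrightarrow> e i \<bullet> z = 0"
proof -
  let ?T = "{y. \<forall>x\<in>S. orthogonal x y}"
  have T: "subspace ?T"
    by (rule subspace_orthogonal_to_vectors)
  have dimT: "dim ?T + dim S = CARD('n)"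
    using dim_subspace_orthogonal_to_vectors[of S UNIV] S by simp
  obtain B where B: "B \<subseteq> S" "pairwise orthogonal B" "\<And>x. x \<in> B \<Longrightarrow> norm x = 1"
    "independent B" "card B = dim S" "span B = S"
    by (rule orthonormal_basis_subspace[OF S]) (rule that; blast)
  obtain C where C: "C \<subseteq> ?T" "pairwise orthogonal C" "\<And>x. x \<in> C \<Longrightarrow> norm x = 1"
    "independent C" "card C = dim ?T" "span C = ?T"
    by (rule orthonormal_basis_subspace[OF T]) (rule that; blast)
  have "finite B"
    by (rule independent_imp_finite) fact
  then obtain f where f: "bij_betw f {..<dim S} B"
    using ex_bij_betw_nat_finite[of B] unfolding atLeast0LessThan B(5) by blast
  have "finite C"
    by (rule independent_imp_finite) fact
  then obtain g where g: "bij_betw g {..<dim ?T} C"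
    using ex_bij_betw_nat_finite[of C] unfolding atLeast0LessThan C(5) by blast
  define e where "e i = (if i < dim S then f i else g (i - dim S))" for i
  have eB: "e i \<in> B" if "i < dim S" for i
    using that bij_betw_apply[OF f, of i] by (simp add: e_def)
  have eC: "e i \<in> C" if "dim S \<le> i" "i < CARD('n)" for i
    using that dimT bij_betw_apply[OF g, of "i - dim S"] by (simp add: e_def)
  have orth: "e i \<bullet> z = 0" if "dim S \<le> i" "i < CARD('n)" "z \<in> S" for i z
    using subsetD[OF C(1) eC[OF that(1,2)]] that(3) by (simp add: orthogonal_def inner_commute)
  have nrm: "e i \<bullet> e i = 1" if "i < CARD('n)" for i
  proof (cases "i < dim S")
    case True
    then show ?thesis using B(3)[OF eB] by (simp add: norm_eq_1)
  next
    case False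
    then show ?thesis using C(3)[OF eC] that by (simp add: norm_eq_1)
  qed
  have neq: "e i \<bullet> e j = 0" if ij: "i < CARD('n)" "j < CARD('n)" "i < j" for i j
  proof (cases "j < dim S")
    case True
    then have "e i \<noteq> e j"
      using ij inj_onD[OF bij_betw_imp_inj_on[OF f], of i j] by (auto simp: e_def)
    then show ?thesis
      using pairwiseD[OF B(2), of "e i" "e j"] eB[of i] eB[of j] True ij by (simp add: orthogonal_def)
  next
    case j: False
    show ?thesis
    proof (cases "i < dim S")
      case True
      then show ?thesis
        using orth[of j "e i"] eB[OF True] B(1) j ij by (simp add: inner_commute subset_iff)
    next
      case False
      have "i - dim S \<noteq> j - dim S" "i - dim S < dim ?T" "j - dim S < dim ?T"
        using ij False j dimT by linarith+
      then have "e i \<noteq> e j"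
        using inj_onD[OF bij_betw_imp_inj_on[OF g], of "i - dim S" "j - dim S"] False j by (auto simp: e_def)
      then show ?thesis
        using pairwiseD[OF C(2), of "e i" "e j"] eC[of i] eC[of j] False j ij by (simp add: orthogonal_def)
    qed
  qed
  show ?thesis
  proof (rule that[of e])
    show "e i \<bullet> e j = (if i = j then 1 else 0)" if "i < CARD('n)" "j < CARD('n)" for i j
      using nrm neq[of i j] neq[of j i] that by (cases i j rule: linorder_cases) (auto simp: inner_commute)
    show "e i \<in> S" if "i < dim S" for i
      using eB[OF that] B(1) by blast
    show "e i \<bullet> z = 0" if "dim S \<le> i" "i < CARD('n)" "z \<in> S" for i z
      by (rule orth[OF that])
  qed
qed

lemma borel_measurable_matrix_vector_mult [measurable]:
  "(\<lambda>y. (A :: real ^ 'n ^ 'm) *v y) \<in> borel_measurable borel"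
  by (rule borel_measurable_linear) (rule matrix_vector_mul_linear)

lemma borel_measurable_resid [measurable]: "resid X \<tau> \<in> borel_measurable borel"
  by (rule borel_measurable_linear[OF linear_resid])

section \<open>The objective functions\<close>

lemma INF_eq_minimum:
  fixes f :: "'a \<Rightarrow> real"
  assumes "x \<in> A" "\<And>y. y \<in> A \<Longrightarrow> f x \<le> f y"
  shows "(INF y\<in>A. f y) = f x"
  by (rule cInf_eq_minimum) (use assms in auto)

text \<open>Fitted means have zero residual, so subtracting one leaves the residual of
  \<open>y\<close> unchanged, and taking residuals does not increase norms. The projection attains
  the bound. The infimum becomes a Borel function of \<open>y\<close>.\<close>

lemma T0_obj_eq:
  "(INF \<beta>\<in>coeff_space \<tau>. (norm (y - model_mean X \<tau> \<beta>))\<^sup>2) = (norm (resid X \<tau> y))\<^sup>2"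
proof -
  obtain b where b: "b \<in> coeff_space \<tau>" "model_mean X \<tau> b = proj_mat X \<tau> *v y"
    using proj_mat_in_column_span[of X \<tau> y] by (auto simp: column_span_eq_image_model_mean)
  have "(INF \<beta>\<in>coeff_space \<tau>. (norm (y - model_mean X \<tau> \<beta>))\<^sup>2) = (norm (y - model_mean X \<tau> b))\<^sup>2"
  proof (rule INF_eq_minimum[OF b(1)])
    fix \<beta>
    have "resid X \<tau> y = resid X \<tau> (y - model_mean X \<tau> \<beta>)"
      by (simp add: linear_diff[OF linear_resid])
    then have "norm (resid X \<tau> y) \<le> norm (y - model_mean X \<tau> \<beta>)"
      using norm_resid_le by metis
    then show "(norm (y - model_mean X \<tau> b))\<^sup>2 \<le> (norm (y - model_mean X \<tau> \<beta>))\<^sup>2"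
      by (simp add: b resid_eq[symmetric] power_mono)
  qed
  then show ?thesis
    by (simp add: b resid_eq)
qed

text \<open>Minimizing over the coefficients leaves the squared residual of
  \<open>y - \<sigma> *\<^sub>R u\<close>, a quadratic in \<sigma> with vertex \<open>a / b\<close>.
  If the residual of \<open>u\<close> vanishes, then \<open>a\<close> and \<open>b\<close> are 0 and
  division by zero gives the right value.\<close>

lemma cand_obj_eq:
  "cand_obj X lam y u \<tau> = (norm (resid X \<tau> y))\<^sup>2
     - (resid X \<tau> y \<bullet> resid X \<tau> u)\<^sup>2 / (norm (resid X \<tau> u))\<^sup>2 + lam * real (card \<tau>)"
proof -
  let ?R = "resid X \<tau>"
  define a where "a = ?R y \<bullet> ?R u"
  define b where "b = (norm (?R u))\<^sup>2"
  have sq: "(norm (?R y - \<sigma> *\<^sub>R ?R u))\<^sup>2 = (norm (?R y))\<^sup>2 - 2 * \<sigma> * a + \<sigma>\<^sup>2 * b" for \<sigma>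
    unfolding a_def b_def power2_norm_eq_inner
    by (simp add: inner_diff_left inner_diff_right inner_commute power2_eq_square algebra_simps)
  have ab: "b = 0 \<Longrightarrow> a = 0"
    by (auto simp: a_def b_def)
  have b0: "b \<ge> 0" by (simp add: b_def)
  have min: "(norm (?R y))\<^sup>2 - a\<^sup>2 / b \<le> (norm (?R y - \<sigma> *\<^sub>R ?R u))\<^sup>2" for \<sigma>
  proof (cases "b = 0")
    case False
    with b0 have b: "b > 0" by simp
    \<comment> \<open>Completing the square in \<sigma>.\<close>
    have "0 \<le> (\<sigma> * b - a)\<^sup>2 / b"
      using b by simp
    also have "\<dots> = \<sigma>\<^sup>2 * b - 2 * \<sigma> * a + a\<^sup>2 / b"
      using b by (simp add: power2_eq_square field_simps)
    finally show ?thesis unfolding sq by simp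
  qed (use ab sq[of \<sigma>] in simp)
  have att: "(norm (?R y - (a / b) *\<^sub>R ?R u))\<^sup>2 = (norm (?R y))\<^sup>2 - a\<^sup>2 / b"
    unfolding sq using ab by (cases "b = 0") (simp_all add: power2_eq_square field_simps)
  let ?y = "y - (a / b) *\<^sub>R u"
  have Rlin: "?R (y - \<sigma> *\<^sub>R u) = ?R y - \<sigma> *\<^sub>R ?R u" for \<sigma>
    by (simp add: linear_diff[OF linear_resid] linear_cmul[OF linear_resid])
  obtain \<beta>' where \<beta>': "\<beta>' \<in> coeff_space \<tau>" "model_mean X \<tau> \<beta>' = proj_mat X \<tau> *v ?y"
    using proj_mat_in_column_span[of X \<tau> ?y] by (auto simp: column_span_eq_image_model_mean)
  let ?f = "\<lambda>(\<beta>, \<sigma>). (norm (y - model_mean X \<tau> \<beta> - \<sigma> *\<^sub>R u))\<^sup>2 + lam * real (card \<tau>)"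
  have f': "?f (\<beta>', a / b) = (norm (?R y))\<^sup>2 - a\<^sup>2 / b + lam * real (card \<tau>)"
    using att Rlin[of "a / b"] by (simp add: \<beta>' resid_eq algebra_simps)
  have "cand_obj X lam y u \<tau> = ?f (\<beta>', a / b)"
    unfolding cand_obj_def
  proof (rule INF_eq_minimum)
    show "(\<beta>', a / b) \<in> coeff_space \<tau> \<times> UNIV"
      using \<beta>' by simp
    fix w :: "(real ^ 'a) \<times> real"
    obtain \<beta> \<sigma> where w: "w = (\<beta>, \<sigma>)" by fastforce
    have "?R y - \<sigma> *\<^sub>R ?R u = ?R (y - model_mean X \<tau> \<beta> - \<sigma> *\<^sub>R u)"
      by (simp add: linear_diff[OF linear_resid] linear_cmul[OF linear_resid])
    then have "norm (?R y - \<sigma> *\<^sub>R ?R u) \<le> norm (y - model_mean X \<tau> \<beta> - \<sigma> *\<^sub>R u)"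
      using norm_resid_le by metis
    then have "(norm (?R y - \<sigma> *\<^sub>R ?R u))\<^sup>2 \<le> (norm (y - model_mean X \<tau> \<beta> - \<sigma> *\<^sub>R u))\<^sup>2"
      by (intro power_mono) auto
    from order_trans[OF min this] show "?f (\<beta>', a / b) \<le> ?f w"
      unfolding f' w by simp
  qed
  then show ?thesis
    unfolding f' unfolding a_def b_def .
qed

text \<open>There are finitely many models, so the set of minimizers is a map into a finite discrete
  space, each fibre being cut out by finitely many comparisons. Any selection from it is then
  measurable too.\<close>

lemma measurable_sel_arg_min:
  fixes g :: "'p::finite set \<Rightarrow> 'x \<Rightarrow> real"
  assumes [measurable]: "\<And>\<tau>. g \<tau> \<in> borel_measurable M"
  shows "(\<lambda>x. sel {\<tau>. is_arg_min (\<lambda>\<tau>. g \<tau> x) P \<tau>}) \<in> measurable M (count_space UNIV)"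
proof -
  let ?h = "\<lambda>x. {\<tau>. is_arg_min (\<lambda>\<tau>. g \<tau> x) P \<tau>}"
  have "?h \<in> measurable M (count_space UNIV)"
  proof (subst measurable_count_space_eq2)
    show "?h \<in> space M \<rightarrow> UNIV \<and> (\<forall>a\<in>UNIV. ?h -` {a} \<inter> space M \<in> sets M)"
    proof safe
      fix a
      have "?h -` {a} \<inter> space M
        = {x \<in> space M. \<forall>\<tau>\<in>UNIV. \<tau> \<in> a \<longleftrightarrow> P \<tau> \<and> (\<forall>\<tau>'\<in>UNIV. P \<tau>' \<longrightarrow> g \<tau> x \<le> g \<tau>' x)}"
        by (auto simp: is_arg_min_linorder)
      also have "\<dots> \<in> sets M"
        by measurable
      finally show "?h -` {a} \<inter> space M \<in> sets M" .
    qed auto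
  qed simp
  then show ?thesis
    by (rule measurable_compose) simp
qed

lemma measurable_T0 [measurable]:
  "(\<lambda>y. T0 sel X y \<tau>) \<in> measurable borel (count_space UNIV)"
  unfolding T0_def T0_obj_eq by (intro measurable_sel_arg_min) measurable

lemma measurable_tau_hat:
  "(\<lambda>(y, u). tau_hat sel X lam y u) \<in> measurable (borel \<Otimes>\<^sub>M borel) (count_space UNIV)"
  unfolding tau_hat_def split_beta' cand_obj_eq[abs_def] by (intro measurable_sel_arg_min) measurable

section \<open>Projection, residual norm and residual direction of a Gaussian vector\<close>

lemma prob_space_std_gaussian: "prob_space (std_gaussian :: (real ^ 'n) measure)"
  unfolding std_gaussian_eq_distr_Basis
  by (intro prob_space.prob_space_distr prob_space_PiM prob_space_std_normal) measurable

lemma sets_std_gaussian [simp, measurable_cong]: "sets std_gaussian = sets borel"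
  and space_std_gaussian [simp]: "space std_gaussian = UNIV"
  by (simp_all add: std_gaussian_def)

text \<open>The value is 0 when the residual vanishes, in agreement with the expression inside
  \<open>model_prob\<close>.\<close>

definition direction :: "real ^ 'p ^ 'n \<Rightarrow> 'p set \<Rightarrow> real ^ 'n \<Rightarrow> real ^ 'n" where
  "direction X \<tau> u = resid X \<tau> u /\<^sub>R norm (resid X \<tau> u)"

lemma measurable_direction [measurable]: "direction X \<tau> \<in> borel_measurable borel"
  unfolding direction_def[abs_def] by measurable

lemma std_gaussian_proj_coordinates:
  fixes X :: "real ^ 'p ^ 'n" and \<tau> :: "'p set"
  defines "k \<equiv> dim (column_span X \<tau>)"
  obtains e :: "nat \<Rightarrow> real ^ 'n"
  where "\<And>i j. i < CARD('n) \<Longrightarrow> j < CARD('n) \<Longrightarrow> e i \<bullet> e j = (if i = j then 1 else 0)"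
    and "std_gaussian = distr (PiM {..<CARD('n)} (\<lambda>_. std_normal)) borel (\<lambda>z. \<Sum>i<CARD('n). z i *\<^sub>R e i)"
    and "\<And>z. proj_mat X \<tau> *v (\<Sum>i<CARD('n). z i *\<^sub>R e i) = (\<Sum>i<k. z i *\<^sub>R e i)"
    and "\<And>z. resid X \<tau> (\<Sum>i<CARD('n). z i *\<^sub>R e i) = (\<Sum>i=k..<CARD('n). z i *\<^sub>R e i)"
proof -
  let ?n = "CARD('n)" and ?S = "column_span X \<tau>"
  obtain e :: "nat \<Rightarrow> real ^ 'n" where e:
    "\<And>i j. i < ?n \<Longrightarrow> j < ?n \<Longrightarrow> e i \<bullet> e j = (if i = j then 1 else 0)"
    "\<And>i. i < k \<Longrightarrow> e i \<in> ?S" "\<And>i z. k \<le> i \<Longrightarrow> i < ?n \<Longrightarrow> z \<in> ?S \<Longrightarrow> e i \<bullet> z = 0"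
    unfolding k_def by (rule orthonormal_basis_extending_subspace[of ?S]) auto
  have kn: "k \<le> ?n"
    using dim_subset_UNIV[of ?S] by (simp add: k_def)
  have split: "(\<Sum>i<?n. z i *\<^sub>R e i) = (\<Sum>i<k. z i *\<^sub>R e i) + (\<Sum>i=k..<?n. z i *\<^sub>R e i)" for z
  proof -
    have "{..<?n} = {..<k} \<union> {k..<?n}" using kn by auto
    moreover have "{..<k} \<inter> {k..<?n} = {}" by auto
    ultimately show ?thesis by (simp add: sum.union_disjoint)
  qed
  have proj: "proj_mat X \<tau> *v (\<Sum>i<?n. z i *\<^sub>R e i) = (\<Sum>i<k. z i *\<^sub>R e i)" for z
  proof (rule proj_mat_unique)
    show "(\<Sum>i<k. z i *\<^sub>R e i) \<in> ?S"
      by (intro subspace_sum subspace_scale subspace_column_span e) auto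
    show "orthogonal ((\<Sum>i<?n. z i *\<^sub>R e i) - (\<Sum>i<k. z i *\<^sub>R e i)) w" if "w \<in> ?S" for w
      using e(3) that by (simp add: split orthogonal_def inner_sum_left)
  qed
  show ?thesis
    by (rule that[of e]) (use e proj std_gaussian_eq_distr_orthonormal[of e] split in \<open>simp_all add: resid_eq\<close>)
qed

text \<open>Integrated form of the statement that the direction is independent of the projection and
  the residual norm: it may be replaced by that of a fresh vector \<open>v\<close>. Projection and
  residual use disjoint coordinate blocks, and inside the residual block norm and direction are
  independent; this block is nonempty by the strict bound on the dimension.\<close>

lemma std_gaussian_resample_direction:
  fixes X :: "real ^ 'p ^ 'n" and f :: "(real ^ 'n) \<times> real \<times> (real ^ 'n) \<Rightarrow> ennreal"
  assumes dim: "dim (column_span X \<tau>) < CARD('n)"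
    and [measurable]: "f \<in> borel_measurable (borel \<Otimes>\<^sub>M borel \<Otimes>\<^sub>M borel)"
  shows "(\<integral>\<^sup>+u. f (proj_mat X \<tau> *v u, norm (resid X \<tau> u), direction X \<tau> u) \<partial>std_gaussian)
    = (\<integral>\<^sup>+u. \<integral>\<^sup>+v. f (proj_mat X \<tau> *v u, norm (resid X \<tau> u), direction X \<tau> v) \<partial>std_gaussian \<partial>std_gaussian)"
proof -
  let ?n = "CARD('n)" and ?k = "dim (column_span X \<tau>)"
  obtain e :: "nat \<Rightarrow> real ^ 'n" where e:
    "\<And>i j. i < ?n \<Longrightarrow> j < ?n \<Longrightarrow> e i \<bullet> e j = (if i = j then 1 else 0)"
    and law: "std_gaussian = distr (PiM {..<?n} (\<lambda>_. std_normal)) borel (\<lambda>z. \<Sum>i<?n. z i *\<^sub>R e i)"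
    and H: "\<And>z. proj_mat X \<tau> *v (\<Sum>i<?n. z i *\<^sub>R e i) = (\<Sum>i<?k. z i *\<^sub>R e i)"
    and R: "\<And>z. resid X \<tau> (\<Sum>i<?n. z i *\<^sub>R e i) = (\<Sum>i=?k..<?n. z i *\<^sub>R e i)"
    by (rule std_gaussian_proj_coordinates[of X \<tau>]) blast
  let ?I = "{..<?k}" and ?J = "{?k..<?n}"
  have IJ: "{..<?n} = ?I \<union> ?J" "?I \<inter> ?J = {}" "finite ?I" "finite ?J"
    using dim by auto
  define PI where "PI = PiM ?I (\<lambda>_. std_normal)"
  define PJ where "PJ = PiM ?J (\<lambda>_. std_normal)"
  interpret N: prob_space std_normal by (rule prob_space_std_normal)
  interpret S: product_sigma_finite "\<lambda>_ :: nat. std_normal" ..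
  interpret PI: prob_space PI unfolding PI_def by (intro prob_space_PiM prob_space_std_normal)
  interpret PJ: prob_space PJ unfolding PJ_def by (intro prob_space_PiM prob_space_std_normal)
  define h where "h z = (\<Sum>i<?k. z i *\<^sub>R e i)" for z
  define l where "l z = (\<Sum>i\<in>?J. z i *\<^sub>R e i)" for z
  have [measurable]: "h \<in> borel_measurable PI" "l \<in> borel_measurable PJ"
    unfolding h_def l_def PI_def PJ_def by measurable
  let ?N = "\<lambda>z. norm (l z)" and ?D = "\<lambda>z. l z /\<^sub>R norm (l z)"
  have fold: "(\<integral>\<^sup>+u. \<phi> (proj_mat X \<tau> *v u) (resid X \<tau> u) \<partial>std_gaussian)
      = (\<integral>\<^sup>+a. \<integral>\<^sup>+b. \<phi> (h a) (l b) \<partial>PJ \<partial>PI)"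
    if [measurable]: "case_prod \<phi> \<in> borel_measurable (borel \<Otimes>\<^sub>M borel)" for \<phi> :: "_ \<Rightarrow> _ \<Rightarrow> ennreal"
  proof -
    have m: "(\<lambda>u. \<phi> (proj_mat X \<tau> *v u) (resid X \<tau> u)) \<in> borel_measurable borel"
      by measurable
    have m': "(\<lambda>z. \<phi> (\<Sum>i<?k. z i *\<^sub>R e i) (\<Sum>i\<in>?J. z i *\<^sub>R e i))
        \<in> borel_measurable (PiM (?I \<union> ?J) (\<lambda>_. std_normal))"
      by measurable
    have "(\<integral>\<^sup>+u. \<phi> (proj_mat X \<tau> *v u) (resid X \<tau> u) \<partial>std_gaussian)
      = (\<integral>\<^sup>+z. \<phi> (\<Sum>i<?k. z i *\<^sub>R e i) (\<Sum>i\<in>?J. z i *\<^sub>R e i) \<partial>PiM (?I \<union> ?J) (\<lambda>_. std_normal))"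
      unfolding law IJ(1)[symmetric] using m by (subst nn_integral_distr) (simp_all add: H R)
    also have "\<dots> = (\<integral>\<^sup>+a. \<integral>\<^sup>+b. \<phi> (h a) (l b) \<partial>PJ \<partial>PI)"
      by (subst S.product_nn_integral_fold[OF IJ(2-4) m'])
         (auto simp: PI_def PJ_def h_def l_def merge_def intro!: nn_integral_cong arg_cong2[where f = \<phi>] sum.cong)
    finally show ?thesis .
  qed
  have polar: "(\<integral>\<^sup>+b. \<psi> (?N b) (?D b) \<partial>PJ) = (\<integral>\<^sup>+b. \<integral>\<^sup>+b'. \<psi> (?N b) (?D b') \<partial>PJ \<partial>PJ)"
    if [measurable]: "case_prod \<psi> \<in> borel_measurable (borel \<Otimes>\<^sub>M borel)" for \<psi> :: "_ \<Rightarrow> _ \<Rightarrow> ennreal"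
  proof -
    interpret Nm: prob_space "distr PJ borel ?N" by (rule PJ.prob_space_distr) measurable
    interpret D: prob_space "distr PJ borel ?D" by (rule PJ.prob_space_distr) measurable
    have *: "distr PJ (borel \<Otimes>\<^sub>M borel) (\<lambda>b. (?N b, ?D b)) = distr PJ borel ?N \<Otimes>\<^sub>M distr PJ borel ?D"
      unfolding PJ_def l_def by (rule std_normal_norm_direction_indep) (use dim e in auto)
    have "(\<integral>\<^sup>+b. \<psi> (?N b) (?D b) \<partial>PJ)
        = (\<integral>\<^sup>+p. case_prod \<psi> p \<partial>distr PJ (borel \<Otimes>\<^sub>M borel) (\<lambda>b. (?N b, ?D b)))"
      by (subst nn_integral_distr) auto
    also have "\<dots> = (\<integral>\<^sup>+s. \<integral>\<^sup>+\<omega>. \<psi> s \<omega> \<partial>distr PJ borel ?D \<partial>distr PJ borel ?N)"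
      unfolding * by (subst D.nn_integral_fst[symmetric]) auto
    also have "\<dots> = (\<integral>\<^sup>+b. \<integral>\<^sup>+b'. \<psi> (?N b) (?D b') \<partial>PJ \<partial>PJ)"
      by (simp add: nn_integral_distr)
    finally show ?thesis .
  qed
  have "(\<integral>\<^sup>+u. f (proj_mat X \<tau> *v u, norm (resid X \<tau> u), direction X \<tau> u) \<partial>std_gaussian)
      = (\<integral>\<^sup>+a. \<integral>\<^sup>+b. f (h a, ?N b, ?D b) \<partial>PJ \<partial>PI)"
    unfolding direction_def by (rule fold[of "\<lambda>x y. f (x, norm y, y /\<^sub>R norm y)"]) measurable
  also have "\<dots> = (\<integral>\<^sup>+a. \<integral>\<^sup>+b. \<integral>\<^sup>+b'. f (h a, ?N b, ?D b') \<partial>PJ \<partial>PJ \<partial>PI)"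
    by (rule nn_integral_cong, rule polar[of "\<lambda>s \<omega>. f (h a, s, \<omega>)" for a]) measurable
  also have "\<dots> = (\<integral>\<^sup>+a. \<integral>\<^sup>+b. \<integral>\<^sup>+v. f (h a, ?N b, direction X \<tau> v) \<partial>std_gaussian \<partial>PJ \<partial>PI)"
  proof (intro nn_integral_cong)
    fix a b
    \<comment> \<open>The integrand does not look at the projection of \<open>v\<close>, so the
      integral over that block contributes only its total mass 1.\<close>
    have "(\<integral>\<^sup>+v. f (h a, ?N b, direction X \<tau> v) \<partial>std_gaussian)
        = (\<integral>\<^sup>+_. \<integral>\<^sup>+b'. f (h a, ?N b, ?D b') \<partial>PJ \<partial>PI)"
      unfolding direction_def by (rule fold[of "\<lambda>x y. f (h a, ?N b, y /\<^sub>R norm y)"]) measurable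
    then show "(\<integral>\<^sup>+b'. f (h a, ?N b, ?D b') \<partial>PJ) = (\<integral>\<^sup>+v. f (h a, ?N b, direction X \<tau> v) \<partial>std_gaussian)"
      by (simp add: PI.emeasure_space_1)
  qed
  also have "\<dots> = (\<integral>\<^sup>+u. \<integral>\<^sup>+v. f (proj_mat X \<tau> *v u, norm (resid X \<tau> u), direction X \<tau> v) \<partial>std_gaussian \<partial>std_gaussian)"
  proof (rule fold[of "\<lambda>x y. \<integral>\<^sup>+v. f (x, norm y, direction X \<tau> v) \<partial>std_gaussian", symmetric])
    interpret G: prob_space "std_gaussian :: (real ^ 'n) measure" by (rule prob_space_std_gaussian)
    show "(\<lambda>(x, y). \<integral>\<^sup>+v. f (x, norm y, direction X \<tau> v) \<partial>std_gaussian) \<in> borel_measurable (borel \<Otimes>\<^sub>M borel)"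
      by measurable
  qed
  finally show ?thesis .
qed

section \<open>Coverage of the two statistics\<close>

text \<open>The limits of the cdf at both ends make the set nonempty and bounded below, so
  \<open>Inf\<close> is a genuine infimum; right-continuity carries the inequality to it, even at a
  jump.\<close>

lemma le_cdf_quantile:
  assumes "real_distribution \<mu>" and q: "0 < q" "q < 1"
  shows "q \<le> cdf \<mu> (quantile \<mu> q)"
proof -
  interpret real_distribution \<mu> by fact
  let ?S = "{x. q \<le> cdf \<mu> x}"
  have "\<forall>\<^sub>F x in at_top. q < cdf \<mu> x"
    using cdf_lim_at_top_prob q(2) by (rule order_tendstoD)
  then have ne: "?S \<noteq> {}"
    by (auto dest!: eventually_happens intro: less_imp_le)
  have "\<forall>\<^sub>F x in at_bot. cdf \<mu> x < q"
    using cdf_lim_at_bot q(1) by (rule order_tendstoD)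
  then obtain m where m: "\<And>x. x \<le> m \<Longrightarrow> cdf \<mu> x < q"
    by (auto simp: eventually_at_bot_linorder)
  have bdd: "bdd_below ?S"
    using m by (intro bdd_belowI[of _ m]) (meson linorder_not_le mem_Collect_eq not_le_imp_less order_less_imp_le)
  have "\<forall>\<^sub>F x in at_right (Inf ?S). q \<le> cdf \<mu> x"
    unfolding eventually_at_right_field
  proof (intro exI[of _ "Inf ?S + 1"] conjI allI impI)
    fix x assume "Inf ?S < x"
    then obtain s where "s \<in> ?S" "s < x"
      using cInf_lessD[OF ne] by blast
    then show "q \<le> cdf \<mu> x"
      using cdf_nondecreasing[of s x] by auto
  qed simp
  moreover have "(cdf \<mu> \<longlongrightarrow> cdf \<mu> (Inf ?S)) (at_right (Inf ?S))"
    using cdf_is_right_cont[of "Inf ?S"] by (simp add: continuous_within)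
  ultimately show ?thesis
    unfolding quantile_def by (intro tendsto_lowerbound[of "cdf \<mu>"]) auto
qed

lemma real_distribution_F: "real_distribution (F_distribution k m)"
proof -
  interpret prob_space "PiM {..<k + m} (\<lambda>_. std_normal)"
    by (intro prob_space_PiM prob_space_std_normal)
  show ?thesis
    unfolding F_distribution_def by (intro real_distribution_distr) measurable
qed

text \<open>Subtracting the true mean leaves \<sigma>0 times the noise, and the square of \<sigma>0
  cancels between numerator and denominator: the statistic is pivotal.\<close>

lemma T_stat_response:
  fixes X :: "real ^ 'p ^ 'n"
  assumes "\<sigma>0 \<noteq> 0"
  shows "T_stat X (response X \<tau> \<beta> \<sigma>0 u) \<tau> \<beta>
    = ((norm (proj_mat X \<tau> *v u))\<^sup>2 / real (card \<tau>)) / ((norm (resid X \<tau> u))\<^sup>2 / real (CARD('n) - card \<tau>))"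
proof -
  have "(\<sigma>0 *\<^sub>R u) \<bullet> (proj_mat X \<tau> *v (\<sigma>0 *\<^sub>R u)) = \<sigma>0\<^sup>2 * (norm (proj_mat X \<tau> *v u))\<^sup>2"
    by (subst inner_proj_mat_self) (simp add: matrix_vector_mult_scaleR power_mult_distrib)
  moreover have "(\<sigma>0 *\<^sub>R u) \<bullet> resid X \<tau> (\<sigma>0 *\<^sub>R u) = \<sigma>0\<^sup>2 * (norm (resid X \<tau> u))\<^sup>2"
    by (subst inner_resid_self) (simp add: linear_cmul[OF linear_resid] power_mult_distrib)
  ultimately show ?thesis
    using assms by (simp add: T_stat_def response_def Let_def resid_def[symmetric])
qed

lemma measurable_T_stat_response [measurable]:
  "\<sigma>0 \<noteq> 0 \<Longrightarrow> (\<lambda>u. T_stat X (response X \<tau> \<beta> \<sigma>0 u) \<tau> \<beta>) \<in> borel_measurable borel"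
  by (subst T_stat_response) measurable

lemma T_stat_coverage:
  fixes X :: "real ^ 'p ^ 'n"
  assumes id: "identifiable X \<tau>0 \<beta>0" and \<sigma>: "\<sigma>0 \<noteq> 0" and a: "0 < \<alpha>2" "\<alpha>2 < 1"
  shows "measure std_gaussian {u. T_stat X (response X \<tau>0 \<beta>0 \<sigma>0 u) \<tau>0 \<beta>0 \<in> B_coeff CARD('n) \<alpha>2 \<tau>0} \<ge> \<alpha>2"
proof -
  let ?n = "CARD('n)" and ?k = "card \<tau>0"
  have dim: "dim (column_span X \<tau>0) = ?k"
    by (rule identifiable_dim_column_span[OF id])
  have kn: "?k \<le> ?n"
    using dim_subset_UNIV[of "column_span X \<tau>0"] dim by simp
  obtain e :: "nat \<Rightarrow> real ^ 'n" where e: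
    "\<And>i j. i < ?n \<Longrightarrow> j < ?n \<Longrightarrow> e i \<bullet> e j = (if i = j then 1 else 0)"
    and law: "std_gaussian = distr (PiM {..<?n} (\<lambda>_. std_normal)) borel (\<lambda>z. \<Sum>i<?n. z i *\<^sub>R e i)"
    and H: "\<And>z. proj_mat X \<tau>0 *v (\<Sum>i<?n. z i *\<^sub>R e i) = (\<Sum>i<?k. z i *\<^sub>R e i)"
    and R: "\<And>z. resid X \<tau>0 (\<Sum>i<?n. z i *\<^sub>R e i) = (\<Sum>i=?k..<?n. z i *\<^sub>R e i)"
    using std_gaussian_proj_coordinates[of X \<tau>0] unfolding dim by blast
  let ?P = "PiM {..<?n} (\<lambda>_. std_normal)" and ?F = "F_distribution ?k (?n - ?k)"
  let ?T = "\<lambda>u. T_stat X (response X \<tau>0 \<beta>0 \<sigma>0 u) \<tau>0 \<beta>0"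
  have T: "?T (\<Sum>i<?n. z i *\<^sub>R e i)
      = ((\<Sum>i<?k. (z i)\<^sup>2) / real ?k) / ((\<Sum>i=?k..<?n. (z i)\<^sup>2) / real (?n - ?k))" for z
    unfolding T_stat_response[OF \<sigma>] H R using kn by (subst (1 2) norm_orthonormal_sum) (auto simp: e)
  have F: "?F = distr std_gaussian borel ?T"
    unfolding F_distribution_def law using kn \<sigma>
    by (subst distr_distr) (auto simp: comp_def T)
  \<comment> \<open>\<open>B_coeff\<close> starts at 0, so nonnegativity identifies it with the
    half-line whose probability the cdf measures.\<close>
  have T0: "?T u \<ge> 0" for u
    unfolding T_stat_response[OF \<sigma>] by simp
  have "\<alpha>2 \<le> cdf ?F (quantile ?F \<alpha>2)"
    using a by (intro le_cdf_quantile real_distribution_F)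
  also have "\<dots> = measure std_gaussian (?T -` {..quantile ?F \<alpha>2} \<inter> UNIV)"
    unfolding cdf_def by (subst F, subst measure_distr) (use \<sigma> in auto)
  also have "?T -` {..quantile ?F \<alpha>2} \<inter> UNIV = {u. ?T u \<in> B_coeff ?n \<alpha>2 \<tau>0}"
    using T0 by (auto simp: B_coeff_def)
  finally show ?thesis .
qed

text \<open>Let \<open>m\<close> be a most probable excluded point. All excluded points are at most
  as probable as \<open>m\<close>, so their total is bounded by the very sum that is below
  \<open>1 - a\<close> because \<open>m\<close> is excluded.\<close>

lemma sum_small_probabilities_le:
  fixes p :: "'a::finite \<Rightarrow> real"
  assumes p: "\<And>x. p x \<ge> 0" and a: "a < 1"
  shows "(\<Sum>x | \<not> (\<Sum>y\<in>{y. p y \<le> p x}. p y) \<ge> 1 - a. p x) \<le> 1 - a"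
proof -
  let ?A = "{x. \<not> (\<Sum>y\<in>{y. p y \<le> p x}. p y) \<ge> 1 - a}"
  show ?thesis
  proof (cases "?A = {}")
    case False
    obtain m where m: "m \<in> ?A" "p m = Max (p ` ?A)"
      using Max_in[of "p ` ?A"] False by fastforce
    have "sum p ?A \<le> (\<Sum>y\<in>{y. p y \<le> p m}. p y)"
      by (rule sum_mono2) (use p m in auto)
    then show ?thesis
      using m(1) by auto
  qed (use a in auto)
qed

lemma measurable_model_prob [measurable]:
  fixes X :: "real ^ 'p ^ 'n"
  shows "(\<lambda>w. model_prob sel X w \<tau> \<tau>') \<in> borel_measurable (borel \<Otimes>\<^sub>M borel)"
proof -
  interpret G: prob_space "std_gaussian :: (real ^ 'n) measure" by (rule prob_space_std_gaussian)
  let ?Q = "{q \<in> space ((borel \<Otimes>\<^sub>M borel) \<Otimes>\<^sub>M std_gaussian).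
    T0 sel X (fst (fst q) + snd (fst q) *\<^sub>R direction X \<tau> (snd q)) \<tau> = \<tau>'}"
  have "?Q \<in> sets ((borel \<Otimes>\<^sub>M borel) \<Otimes>\<^sub>M std_gaussian)"
    by measurable
  from G.measurable_emeasure_Pair[OF this]
  have "(\<lambda>w. enn2real (emeasure std_gaussian (Pair w -` ?Q))) \<in> borel_measurable (borel \<Otimes>\<^sub>M borel)"
    by measurable
  moreover have "Pair w -` ?Q = {v. T0 sel X (fst w + snd w *\<^sub>R (resid X \<tau> v /\<^sub>R norm (resid X \<tau> v))) \<tau> = \<tau>'}" for w
    by (auto simp: space_pair_measure direction_def)
  ultimately show ?thesis
    by (simp add: model_prob_def measure_def)
qed

text \<open>The index set of the sum in \<open>B_model\<close> varies with \<open>w\<close>. A sum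
  over all models with a conditional summand has a fixed range, to which the measurability rules
  apply.\<close>

lemma B_model_iff:
  "\<tau>' \<in> B_model sel X \<alpha>1 \<tau> w \<longleftrightarrow>
    (\<Sum>\<tau>''\<in>UNIV. if model_prob sel X w \<tau> \<tau>'' \<le> model_prob sel X w \<tau> \<tau>' then model_prob sel X w \<tau> \<tau>'' else 0) \<ge> 1 - \<alpha>1"
  by (simp add: B_model_def sum.If_cases)

lemma pred_B_model [measurable]:
  assumes [measurable]: "f \<in> measurable M (borel \<Otimes>\<^sub>M borel)" "g \<in> measurable M (count_space UNIV)"
  shows "Measurable.pred M (\<lambda>x. g x \<in> B_model sel X \<alpha>1 \<tau> (f x))"
proof -
  have "(\<lambda>x. g x \<in> B_model sel X \<alpha>1 \<tau> (f x)) = (\<lambda>x. \<exists>\<tau>'\<in>UNIV. g x = \<tau>' \<and>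
     (\<Sum>\<tau>''\<in>UNIV. if model_prob sel X (f x) \<tau> \<tau>'' \<le> model_prob sel X (f x) \<tau> \<tau>'
        then model_prob sel X (f x) \<tau> \<tau>'' else 0) \<ge> 1 - \<alpha>1)"
    by (simp add: B_model_iff)
  also have "Measurable.pred M \<dots>"
    by measurable
  finally show ?thesis .
qed

lemma measurable_response [measurable]: "response X \<tau> \<beta> \<sigma> \<in> borel_measurable borel"
  unfolding response_def[abs_def] by measurable

lemma measurable_W_stat [measurable]: "(\<lambda>y. W_stat X y \<tau>) \<in> measurable borel (borel \<Otimes>\<^sub>M borel)"
  unfolding W_stat_def by measurable

lemma sets_T0_in: "{v. T0 sel X (a + b *\<^sub>R direction X \<tau> v) \<tau> \<in> S} \<in> sets borel"
proof -
  have "(\<lambda>v. T0 sel X (a + b *\<^sub>R direction X \<tau> v) \<tau>) \<in> measurable borel (count_space UNIV)"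
    by measurable
  from measurable_sets[OF this, of S] show ?thesis
    by (simp add: vimage_def)
qed

text \<open>With \<open>w\<close> fixed the set \<open>B_model\<close> is not random. The events on
  which \<open>T0\<close> takes the various values are disjoint, and the values left out carry total
  probability at most \<open>1 - \<alpha>1\<close>.\<close>

lemma B_model_conditional_coverage:
  fixes X :: "real ^ 'p ^ 'n"
  assumes a: "\<alpha>1 < 1"
  shows "measure std_gaussian {v. T0 sel X (fst w + snd w *\<^sub>R direction X \<tau> v) \<tau> \<in> B_model sel X \<alpha>1 \<tau> w} \<ge> \<alpha>1"
proof -
  interpret G: prob_space "std_gaussian :: (real ^ 'n) measure" by (rule prob_space_std_gaussian)
  let ?p = "model_prob sel X w \<tau>" and ?B = "B_model sel X \<alpha>1 \<tau> w"
  let ?E = "\<lambda>\<tau>'. {v. T0 sel X (fst w + snd w *\<^sub>R direction X \<tau> v) \<tau> = \<tau>'}"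
  have E: "?E \<tau>' \<in> sets std_gaussian" for \<tau>'
    by simp
  have "measure std_gaussian (\<Union>\<tau>'\<in>-?B. ?E \<tau>') = (\<Sum>\<tau>'\<in>-?B. measure std_gaussian (?E \<tau>'))"
    by (rule measure_UNION') (use E in \<open>auto simp: pairwise_def disjnt_def G.fmeasurable_eq_sets\<close>)
  also have "\<dots> = (\<Sum>\<tau>'\<in>-?B. ?p \<tau>')"
    by (simp add: model_prob_def direction_def)
  also have "\<dots> \<le> 1 - \<alpha>1"
  proof -
    have "-?B = {x. \<not> (\<Sum>y\<in>{y. ?p y \<le> ?p x}. ?p y) \<ge> 1 - \<alpha>1}"
      by (auto simp: B_model_def)
    then show ?thesis
      using sum_small_probabilities_le[of ?p \<alpha>1] a by (simp add: model_prob_def)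
  qed
  finally have "measure std_gaussian (space std_gaussian - (\<Union>\<tau>'\<in>-?B. ?E \<tau>')) \<ge> \<alpha>1"
    using E by (subst G.prob_compl) auto
  also have "space std_gaussian - (\<Union>\<tau>'\<in>-?B. ?E \<tau>')
      = {v. T0 sel X (fst w + snd w *\<^sub>R direction X \<tau> v) \<tau> \<in> ?B}"
    by auto
  finally show ?thesis .
qed

text \<open>Redrawing the direction while keeping projection and residual norm fixes the set
  \<open>B_model\<close>, so the conditional bound applies; averaging over the noise keeps
  it.\<close>

lemma T0_coverage:
  fixes X :: "real ^ 'p ^ 'n"
  assumes id: "identifiable X \<tau>0 \<beta>0" and \<sigma>: "\<sigma>0 > 0" and a: "\<alpha>1 < 1" and kn: "card \<tau>0 < CARD('n)"
  defines "y \<equiv> response X \<tau>0 \<beta>0 \<sigma>0"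
  shows "measure std_gaussian {u. T0 sel X (y u) \<tau>0 \<in> B_model sel X \<alpha>1 \<tau>0 (W_stat X (y u) \<tau>0)} \<ge> \<alpha>1"
proof -
  interpret G: prob_space "std_gaussian :: (real ^ 'n) measure" by (rule prob_space_std_gaussian)
  let ?\<mu> = "model_mean X \<tau>0 \<beta>0"
  define W where "W h s = (?\<mu> + \<sigma>0 *\<^sub>R h, \<sigma>0 * s)" for h :: "real ^ 'n" and s :: real
  define Q where "Q = (\<lambda>(h, s, \<omega>). T0 sel X (fst (W h s) + snd (W h s) *\<^sub>R \<omega>) \<tau>0 \<in> B_model sel X \<alpha>1 \<tau>0 (W h s))"
  define f :: "(real ^ 'n) \<times> real \<times> (real ^ 'n) \<Rightarrow> ennreal" where "f x = indicator {x. Q x} x" for x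
  have [measurable]: "Measurable.pred (borel \<Otimes>\<^sub>M borel \<Otimes>\<^sub>M borel) Q"
    unfolding Q_def W_def split_beta' by measurable
  have [measurable]: "f \<in> borel_measurable (borel \<Otimes>\<^sub>M borel \<Otimes>\<^sub>M borel)"
    unfolding f_def by measurable
  \<comment> \<open>The true mean has zero residual, so the statistic sees the noise only through
    its projection and its residual norm.\<close>
  have WW: "W_stat X (y u) \<tau>0 = W (proj_mat X \<tau>0 *v u) (norm (resid X \<tau>0 u))" for u
    using \<sigma> by (simp add: W_stat_def W_def y_def response_def matrix_vector_right_distrib matrix_vector_mult_scaleR
        proj_mat_id[OF model_mean_in_column_span] linear_add[OF linear_resid] linear_cmul[OF linear_resid])
  \<comment> \<open>The response is recovered from the statistic together with the direction of the
    noise; this is the same formula as in \<open>model_prob\<close>, with the actual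
    direction.\<close>
  have yW: "y u = fst (W (proj_mat X \<tau>0 *v u) (norm (resid X \<tau>0 u)))
      + snd (W (proj_mat X \<tau>0 *v u) (norm (resid X \<tau>0 u))) *\<^sub>R direction X \<tau>0 u" for u
  proof -
    have "norm (resid X \<tau>0 u) *\<^sub>R direction X \<tau>0 u = resid X \<tau>0 u"
      by (cases "resid X \<tau>0 u = 0") (simp_all add: direction_def)
    then have "(\<sigma>0 * norm (resid X \<tau>0 u)) *\<^sub>R direction X \<tau>0 u = \<sigma>0 *\<^sub>R resid X \<tau>0 u"
      by (metis scaleR_scaleR)
    then show ?thesis
      by (simp add: W_def y_def response_def resid_eq scaleR_diff_right)
  qed
  have Qy: "Q (proj_mat X \<tau>0 *v u, norm (resid X \<tau>0 u), direction X \<tau>0 u)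
      \<longleftrightarrow> T0 sel X (y u) \<tau>0 \<in> B_model sel X \<alpha>1 \<tau>0 (W_stat X (y u) \<tau>0)" for u
    unfolding Q_def WW by (simp add: yW[symmetric])
  have dim: "dim (column_span X \<tau>0) < CARD('n)"
    using identifiable_dim_column_span[OF id] kn by simp
  have "ennreal \<alpha>1 = (\<integral>\<^sup>+(u :: real ^ 'n). ennreal \<alpha>1 \<partial>std_gaussian)"
    using G.emeasure_space_1 by simp
  also have "\<dots> \<le> (\<integral>\<^sup>+u. \<integral>\<^sup>+v. f (proj_mat X \<tau>0 *v u, norm (resid X \<tau>0 u), direction X \<tau>0 v) \<partial>std_gaussian \<partial>std_gaussian)"
  proof (rule nn_integral_mono)
    fix u
    let ?w = "W (proj_mat X \<tau>0 *v u) (norm (resid X \<tau>0 u))"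
    have "(\<integral>\<^sup>+v. f (proj_mat X \<tau>0 *v u, norm (resid X \<tau>0 u), direction X \<tau>0 v) \<partial>std_gaussian)
       = (\<integral>\<^sup>+v. indicator {v. T0 sel X (fst ?w + snd ?w *\<^sub>R direction X \<tau>0 v) \<tau>0 \<in> B_model sel X \<alpha>1 \<tau>0 ?w} v \<partial>std_gaussian)"
      by (intro nn_integral_cong) (simp add: f_def Q_def indicator_def)
    also have "\<dots> = emeasure std_gaussian {v. T0 sel X (fst ?w + snd ?w *\<^sub>R direction X \<tau>0 v) \<tau>0 \<in> B_model sel X \<alpha>1 \<tau>0 ?w}"
      by (rule nn_integral_indicator) (simp add: sets_T0_in)
    finally show "ennreal \<alpha>1 \<le> (\<integral>\<^sup>+v. f (proj_mat X \<tau>0 *v u, norm (resid X \<tau>0 u), direction X \<tau>0 v) \<partial>std_gaussian)"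
      using B_model_conditional_coverage[OF a, where w = ?w]
      by (simp add: G.emeasure_eq_measure)
  qed
  also have "\<dots> = (\<integral>\<^sup>+u. f (proj_mat X \<tau>0 *v u, norm (resid X \<tau>0 u), direction X \<tau>0 u) \<partial>std_gaussian)"
    by (rule std_gaussian_resample_direction[OF dim, symmetric]) measurable
  also have "\<dots> = (\<integral>\<^sup>+u. indicator {u. T0 sel X (y u) \<tau>0 \<in> B_model sel X \<alpha>1 \<tau>0 (W_stat X (y u) \<tau>0)} u \<partial>std_gaussian)"
    by (intro nn_integral_cong) (simp add: f_def Qy indicator_def)
  also have "\<dots> = emeasure std_gaussian {u. T0 sel X (y u) \<tau>0 \<in> B_model sel X \<alpha>1 \<tau>0 (W_stat X (y u) \<tau>0)}"
    unfolding y_def by (rule nn_integral_indicator) measurable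
  finally show ?thesis
    by (simp add: G.emeasure_eq_measure)
qed

section \<open>Independent copies hitting a random set\<close>

lemma indep_vars_split_first:
  fixes U :: "'a \<Rightarrow> 'b::topological_space" and Us :: "nat \<Rightarrow> 'a \<Rightarrow> 'b"
  assumes "prob_space M" and indep: "prob_space.indep_vars M (\<lambda>_. borel) (case_option U Us) UNIV"
  defines "V \<equiv> \<lambda>d \<omega>. \<lambda>b\<in>{..<d}. Us b \<omega>" and "P \<equiv> \<lambda>d :: nat. PiM {..<d} (\<lambda>_. borel :: 'b measure)"
  shows "U \<in> borel_measurable M" "V d \<in> measurable M (P d)"
    and "distr M borel U \<Otimes>\<^sub>M distr M (P d) (V d) = distr M (borel \<Otimes>\<^sub>M P d) (\<lambda>\<omega>. (U \<omega>, V d \<omega>))"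
proof -
  interpret prob_space M by fact
  let ?X = "case_option U Us"
  define a :: "(nat option \<Rightarrow> 'b) \<Rightarrow> 'b" where "a x = x None" for x
  define f :: "(nat option \<Rightarrow> 'b) \<Rightarrow> nat \<Rightarrow> 'b" where "f x = (\<lambda>b\<in>{..<d}. x (Some b))" for x
  let ?K1 = "PiM {None :: nat option} (\<lambda>_. borel :: 'b measure)"
    and ?K2 = "PiM (Some ` {..<d}) (\<lambda>_. borel :: 'b measure)"
  let ?X1 = "\<lambda>\<omega>. restrict (\<lambda>i. ?X i \<omega>) {None}" and ?X2 = "\<lambda>\<omega>. restrict (\<lambda>i. ?X i \<omega>) (Some ` {..<d})"
  have iv: "indep_var ?K1 ?X1 ?K2 ?X2"
    by (rule indep_var_restrict[OF indep]) auto
  have rv: "random_variable ?K1 ?X1" "random_variable ?K2 ?X2"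
    by (rule indep_var_rv1[OF iv], rule indep_var_rv2[OF iv])
  have ma: "a \<in> measurable ?K1 borel" and mf: "f \<in> measurable ?K2 (P d)"
    unfolding a_def f_def P_def
    by (auto intro!: measurable_restrict measurable_component_singleton)
  have U: "a \<circ> ?X1 = U" and V: "f \<circ> ?X2 = V d"
    by (auto simp: a_def f_def V_def fun_eq_iff)
  show rvU: "U \<in> borel_measurable M"
    using measurable_comp[OF rv(1) ma] by (simp only: U)
  show rvV: "V d \<in> measurable M (P d)"
    using measurable_comp[OF rv(2) mf] by (simp only: V)
  interpret V: prob_space "distr M (P d) (V d)"
    by (rule prob_space_distr) (rule rvV)
  have dU: "distr M borel U = distr (distr M ?K1 ?X1) borel a"
    by (simp only: distr_distr[OF ma rv(1)] U)
  have dV: "distr M (P d) (V d) = distr (distr M ?K2 ?X2) (P d) f"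
    by (simp only: distr_distr[OF mf rv(2)] V)
  have "distr M borel U \<Otimes>\<^sub>M distr M (P d) (V d)
      = distr (distr M ?K1 ?X1 \<Otimes>\<^sub>M distr M ?K2 ?X2) (borel \<Otimes>\<^sub>M P d) (\<lambda>(x, y). (a x, f y))"
    unfolding dU dV
  proof (rule pair_measure_distr)
    show "a \<in> measurable (distr M ?K1 ?X1) borel" "f \<in> measurable (distr M ?K2 ?X2) (P d)"
      using ma mf by (simp_all only: measurable_distr_eq1)
    show "sigma_finite_measure (distr (distr M ?K2 ?X2) (P d) f)"
      using V.sigma_finite_measure_axioms by (simp only: dV)
  qed
  also have "distr M ?K1 ?X1 \<Otimes>\<^sub>M distr M ?K2 ?X2 = distr M (?K1 \<Otimes>\<^sub>M ?K2) (\<lambda>\<omega>. (?X1 \<omega>, ?X2 \<omega>))"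
    using iv unfolding indep_var_distribution_eq by blast
  also have "distr \<dots> (borel \<Otimes>\<^sub>M P d) (\<lambda>(x, y). (a x, f y))
      = distr M (borel \<Otimes>\<^sub>M P d) ((\<lambda>(x, y). (a x, f y)) \<circ> (\<lambda>\<omega>. (?X1 \<omega>, ?X2 \<omega>)))"
  proof (rule distr_distr)
    show "(\<lambda>(x, y). (a x, f y)) \<in> measurable (?K1 \<Otimes>\<^sub>M ?K2) (borel \<Otimes>\<^sub>M P d)"
      using ma mf by measurable
    show "(\<lambda>\<omega>. (?X1 \<omega>, ?X2 \<omega>)) \<in> measurable M (?K1 \<Otimes>\<^sub>M ?K2)"
      using rv by (rule measurable_Pair)
  qed
  also have "(\<lambda>(x, y). (a x, f y)) \<circ> (\<lambda>\<omega>. (?X1 \<omega>, ?X2 \<omega>)) = (\<lambda>\<omega>. (U \<omega>, V d \<omega>))"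
  proof
    fix \<omega>
    show "((\<lambda>(x, y). (a x, f y)) \<circ> (\<lambda>\<omega>. (?X1 \<omega>, ?X2 \<omega>))) \<omega> = (U \<omega>, V d \<omega>)"
      using fun_cong[OF U, of \<omega>] fun_cong[OF V, of \<omega>] by (simp only: comp_def prod.case)
  qed
  finally show "distr M borel U \<Otimes>\<^sub>M distr M (P d) (V d) = distr M (borel \<Otimes>\<^sub>M P d) (\<lambda>\<omega>. (U \<omega>, V d \<omega>))" .
qed

lemma indep_vars_reindex_case_option:
  fixes U :: "'a \<Rightarrow> 'b::topological_space" and Us :: "nat \<Rightarrow> 'a \<Rightarrow> 'b"
  assumes "prob_space M" and indep: "prob_space.indep_vars M (\<lambda>_. borel) (case_option U Us) UNIV"
  shows "prob_space.indep_vars M (\<lambda>_. borel) Us I"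
proof -
  interpret prob_space M by fact
  let ?S = "\<lambda>i. {case_option U Us i -` A \<inter> space M | A. A \<in> sets borel}"
  have "random_variable borel (Us b)" for b
    using indep unfolding indep_vars_def by (auto dest: spec[of _ "Some b"])
  moreover have "indep_sets ?S UNIV"
    using indep unfolding indep_vars_def2 by simp
  then have "indep_sets (\<lambda>b. ?S (Some b)) I"
  proof (intro indep_setsI)
    fix b assume "indep_sets ?S UNIV"
    then have "\<forall>i\<in>UNIV. ?S i \<subseteq> events"
      unfolding indep_sets_def by blast
    then show "?S (Some b) \<subseteq> events"
      by (rule bspec) simp
  next
    fix A J assume S: "indep_sets ?S UNIV" and J: "J \<noteq> {}" "J \<subseteq> I" "finite J" "\<forall>j\<in>J. A j \<in> ?S (Some j)"
    have "prob (\<Inter>j\<in>Some ` J. A (the j)) = (\<Prod>j\<in>Some ` J. prob (A (the j)))"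
      by (rule indep_setsD[OF S]) (use J in auto)
    then show "prob (\<Inter>j\<in>J. A j) = (\<Prod>j\<in>J. prob (A j))"
      by (simp add: prod.reindex)
  qed
  ultimately show ?thesis
    unfolding indep_vars_def2 by simp
qed

text \<open>Given \<open>U = u\<close> in \<open>A\<close>, the \<open>d\<close> copies are
  independent of each other and each misses the section of \<open>Z\<close> at \<open>u\<close> with
  probability at most \<open>q\<close>; the bound does not depend on \<open>u\<close> and survives
  integration over it.\<close>

lemma prob_all_miss_le:
  fixes U :: "'a \<Rightarrow> 'b::second_countable_topology" and Us :: "nat \<Rightarrow> 'a \<Rightarrow> 'b"
  assumes "prob_space M" and indep: "prob_space.indep_vars M (\<lambda>_. borel) (case_option U Us) UNIV"
    and Us: "\<And>b. distr M borel (Us b) = \<nu>"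
    and A [measurable]: "A \<in> sets borel" and Z [measurable]: "Z \<in> sets (borel \<Otimes>\<^sub>M borel)"
    and q: "\<And>u. u \<in> A \<Longrightarrow> measure \<nu> (Pair u -` Z) \<ge> 1 - q" "q \<ge> 0"
  shows "measure M {\<omega> \<in> space M. U \<omega> \<in> A \<and> (\<forall>b<d. (U \<omega>, Us b \<omega>) \<notin> Z)} \<le> q ^ d"
proof (cases "d = 0")
  case True
  interpret prob_space M by fact
  show ?thesis using True by simp
next
  case False
  interpret prob_space M by fact
  note iv = indep_vars_split_first[OF assms(1) indep]
  have rvU [measurable]: "random_variable borel U"
    by (rule iv(1))
  have iU: "indep_vars (\<lambda>_. borel) Us {..<d}"
    by (rule indep_vars_reindex_case_option) fact+
  have rvUs [measurable]: "random_variable borel (Us b)" for b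
    using indep_vars_reindex_case_option[OF assms(1) indep, of UNIV] by (auto simp: indep_vars_def)
  let ?V = "\<lambda>\<omega>. \<lambda>b\<in>{..<d}. Us b \<omega>" and ?P = "PiM {..<d} (\<lambda>_. borel :: 'b measure)"
  have \<nu>sets [measurable_cong, simp]: "sets \<nu> = sets borel" and \<nu>space [simp]: "space \<nu> = UNIV"
    by (simp_all add: Us[of 0, symmetric])
  interpret \<nu>: prob_space \<nu>
    unfolding Us[of 0, symmetric] by (rule prob_space_distr) measurable
  interpret P\<nu>: product_prob_space "\<lambda>_ :: nat. \<nu>" ..
  interpret PV: prob_space "PiM {..<d} (\<lambda>_. \<nu>)"
    by (intro prob_space_PiM) unfold_locales
  interpret \<mu>: prob_space "distr M borel U"
    by (rule prob_space_distr) measurable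
  \<comment> \<open>The characterization of independence by a product law wants a nonempty index
    set, which is why \<open>d = 0\<close> was treated apart.\<close>
  have lawV: "distr M ?P ?V = PiM {..<d} (\<lambda>_. \<nu>)"
  proof -
    have "{..<d} \<noteq> {}"
      using False by (auto simp: lessThan_empty_iff)
    then show ?thesis
      using indep_vars_iff_distr_eq_PiM'[where I = "{..<d}" and M' = "\<lambda>_. borel" and X = Us] iU
      by (simp add: Us)
  qed
  have law: "distr M borel U \<Otimes>\<^sub>M PiM {..<d} (\<lambda>_. \<nu>) = distr M (borel \<Otimes>\<^sub>M ?P) (\<lambda>\<omega>. (U \<omega>, ?V \<omega>))"
    unfolding lawV[symmetric] by (rule iv(3))
  let ?Q = "{p \<in> space (borel \<Otimes>\<^sub>M ?P). fst p \<in> A \<and> (\<forall>b<d. (fst p, snd p b) \<notin> Z)}"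
  have mb: "{p \<in> space (borel \<Otimes>\<^sub>M ?P). (fst p, snd p b) \<notin> Z} \<in> sets (borel \<Otimes>\<^sub>M ?P)" if "b \<in> {..<d}" for b
  proof -
    have "(\<lambda>p. (fst p, snd p b)) \<in> measurable (borel \<Otimes>\<^sub>M ?P) (borel \<Otimes>\<^sub>M borel)"
      using that by measurable
    from measurable_sets[OF this, of "- Z"] have "(\<lambda>p. (fst p, snd p b)) -` (- Z) \<inter> space (borel \<Otimes>\<^sub>M ?P) \<in> sets (borel \<Otimes>\<^sub>M ?P)"
      using sets.compl_sets[OF Z] by (simp add: space_pair_measure Compl_eq_Diff_UNIV)
    then show ?thesis
      by (simp add: vimage_def Int_def conj_commute)
  qed
  have Q: "?Q \<in> sets (borel \<Otimes>\<^sub>M ?P)"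
  proof -
    have "?Q = {p \<in> space (borel \<Otimes>\<^sub>M ?P). fst p \<in> A}
        \<inter> (\<Inter>b\<in>{..<d}. {p \<in> space (borel \<Otimes>\<^sub>M ?P). (fst p, snd p b) \<notin> Z})"
      using False by auto
    also have "\<dots> \<in> sets (borel \<Otimes>\<^sub>M ?P)"
      using mb False by (intro sets.Int sets.finite_INT) (auto simp: lessThan_empty_iff)
    finally show ?thesis .
  qed
  have "emeasure M {\<omega> \<in> space M. U \<omega> \<in> A \<and> (\<forall>b<d. (U \<omega>, Us b \<omega>) \<notin> Z)}
      = emeasure (distr M (borel \<Otimes>\<^sub>M ?P) (\<lambda>\<omega>. (U \<omega>, ?V \<omega>))) ?Q"
    using Q by (subst emeasure_distr)
      (auto intro!: arg_cong2[where f = emeasure] simp: space_pair_measure space_PiM)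
  also have "\<dots> = (\<integral>\<^sup>+u. emeasure (PiM {..<d} (\<lambda>_. \<nu>)) (Pair u -` ?Q) \<partial>distr M borel U)"
    unfolding law[symmetric]
  proof (rule PV.emeasure_pair_measure_alt)
    have "sets (distr M borel U \<Otimes>\<^sub>M PiM {..<d} (\<lambda>_. \<nu>)) = sets (borel \<Otimes>\<^sub>M ?P)"
      by (intro sets_pair_measure_cong sets_PiM_cong) auto
    then show "?Q \<in> sets (distr M borel U \<Otimes>\<^sub>M PiM {..<d} (\<lambda>_. \<nu>))"
      using Q by simp
  qed
  also have "\<dots> \<le> (\<integral>\<^sup>+u. ennreal (q ^ d) \<partial>distr M borel U)"
  proof (rule nn_integral_mono)
    fix u
    show "emeasure (PiM {..<d} (\<lambda>_. \<nu>)) (Pair u -` ?Q) \<le> ennreal (q ^ d)"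
    proof (cases "u \<in> A")
      case True
      have Zu: "Pair u -` Z \<in> sets \<nu>"
        using sets_Pair1[OF Z] by simp
      have "Pair u -` ?Q = Pi\<^sub>E {..<d} (\<lambda>_. - (Pair u -` Z))"
        using True by (auto simp: space_pair_measure space_PiM PiE_def Pi_iff extensional_def)
      then have "emeasure (PiM {..<d} (\<lambda>_. \<nu>)) (Pair u -` ?Q) = (\<Prod>b<d. emeasure \<nu> (- (Pair u -` Z)))"
        using Zu by (simp add: P\<nu>.emeasure_PiM Compl_eq_Diff_UNIV sets.Diff)
      also have "\<dots> \<le> ennreal (q ^ d)"
      proof -
        have "measure \<nu> (- (Pair u -` Z)) \<le> q"
          using q(1)[OF True] \<nu>.prob_compl[OF Zu] by (simp add: Compl_eq_Diff_UNIV)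
        then show ?thesis
          using q(2) by (simp add: \<nu>.emeasure_eq_measure ennreal_power power_mono)
      qed
      finally show ?thesis .
    qed simp
  qed
  also have "\<dots> = ennreal (q ^ d)"
    using \<mu>.emeasure_space_1 by simp
  finally show ?thesis
    using q(2) by (simp add: emeasure_eq_measure)
qed

lemma real_cond_exp_indicator_indep:
  assumes "prob_space M" and rv [measurable]: "U \<in> measurable M N" "V \<in> measurable M K"
    and law: "distr M N U \<Otimes>\<^sub>M distr M K V = distr M (N \<Otimes>\<^sub>M K) (\<lambda>\<omega>. (U \<omega>, V \<omega>))" and A: "A \<in> sets N"
    and G: "G = vimage_algebra (space M) V K"
  shows "AE \<omega> in M. real_cond_exp M G (indicator {\<omega> \<in> space M. U \<omega> \<in> A}) \<omega> = measure M {\<omega> \<in> space M. U \<omega> \<in> A}"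
proof -
  interpret prob_space M by fact
  have V: "V \<in> space M \<rightarrow> space K"
    using measurable_space[OF rv(2)] by auto
  have setsG: "sets G = {V -` B \<inter> space M | B. B \<in> sets K}"
    unfolding G by (rule sets_vimage_algebra2[OF V])
  have sub: "subalgebra M G"
    unfolding subalgebra_def setsG using rv(2) by (auto simp: G measurable_sets)
  interpret finite_measure_subalgebra M G
    by unfold_locales (rule sub)
  interpret DV: prob_space "distr M K V"
    by (rule prob_space_distr) (rule rv)
  let ?A = "{\<omega> \<in> space M. U \<omega> \<in> A}"
  have [measurable]: "?A \<in> sets M"
    using A by measurable
  show ?thesis
  proof (rule real_cond_exp_charact)
    fix B assume "B \<in> sets G"
    then obtain B' where B': "B' \<in> sets K" "B = V -` B' \<inter> space M"
      by (auto simp: setsG)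
    then have [measurable]: "B \<in> sets M"
      using measurable_sets[OF rv(2)] by auto
    have "(\<integral>\<omega>\<in>B. indicator ?A \<omega> \<partial>M) = measure M (?A \<inter> B)"
      by (simp add: set_lebesgue_integral_def indicator_inter_arith[symmetric] Int_commute)
    also have "?A \<inter> B = (\<lambda>x. (U x, V x)) -` (A \<times> B') \<inter> space M"
      by (auto simp: B')
    also have "prob \<dots> = measure (distr M N U \<Otimes>\<^sub>M distr M K V) (A \<times> B')"
      unfolding law using A B'(1) by (subst measure_distr) auto
    also have "\<dots> = prob (U -` A \<inter> space M) * prob (V -` B' \<inter> space M)"
      using A B'(1) by (simp add: measure_def DV.emeasure_pair_measure_Times enn2real_mult emeasure_distr)
    also have "U -` A \<inter> space M = ?A"
      by auto
    also have "prob ?A * prob (V -` B' \<inter> space M) = (\<integral>\<omega>\<in>B. prob ?A \<partial>M)"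
      by (simp add: B' set_lebesgue_integral_def mult.commute)
    finally show "(\<integral>\<omega>\<in>B. indicator ?A \<omega> \<partial>M) = (\<integral>\<omega>\<in>B. prob ?A \<partial>M)" .
  next
    show "integrable M (indicator ?A :: _ \<Rightarrow> real)"
      by (intro integrable_real_indicator) (auto simp: less_top[symmetric])
  qed auto
qed

text \<open>\<open>A0\<close> is the event wanted of the true noise, \<open>A\<close> its part on
  which the hit probability is at least \<open>p\<close>. The event \<open>U \<in> A\<close> without
  the event that all copies miss is contained in \<open>E d\<close>, so both claims reduce to the
  size of the miss event.\<close>

lemma coverage_of_random_candidates:
  fixes U :: "'a \<Rightarrow> real ^ 'n" and Us :: "nat \<Rightarrow> 'a \<Rightarrow> real ^ 'n"
  assumes "prob_space M" and indep: "prob_space.indep_vars M (\<lambda>_. borel) (case_option U Us) UNIV"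
    and Us: "\<And>b. distr M borel (Us b) = \<nu>"
    and A [measurable]: "A \<in> sets borel" and A0 [measurable]: "A0 \<in> sets borel" and AA: "A \<subseteq> A0"
    and Z [measurable]: "Z \<in> sets (borel \<Otimes>\<^sub>M borel)"
    and p: "p > 0" "\<And>u. u \<in> A \<Longrightarrow> measure \<nu> (Pair u -` Z) \<ge> p"
    and c: "measure M {\<omega> \<in> space M. U \<omega> \<in> A} \<ge> c"
  defines "E \<equiv> \<lambda>d. {\<omega> \<in> space M. U \<omega> \<in> A0 \<and> (\<exists>b<d. (U \<omega>, Us b \<omega>) \<in> Z)}"
  shows "\<exists>c1>0.
       (\<exists>r. r \<in> o(\<lambda>d. exp (- c1 * real d)) \<and> (\<forall>d. measure M (E d) \<ge> c - r d)) \<and>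
       (\<exists>R. (\<forall>d. R d \<in> borel_measurable (gen_sigma M d Us)) \<and>
          small_op M R (\<lambda>d. exp (- c1 * real d)) \<and>
          (\<forall>d. AE \<omega> in M. cond_prob_given M (gen_sigma M d Us) (E d) \<omega> \<ge> c - R d \<omega>))"
proof -
  interpret prob_space M by fact
  \<comment> \<open>The square root of the miss rate: the miss probability is at most
    \<open>s ^ d * s ^ d\<close>, so after division by \<open>s ^ d\<close> a vanishing factor
    remains in both claims. The minimum with \<open>1/2\<close> keeps \<open>s\<close> positive for
    the logarithm.\<close>
  define s where "s = sqrt (1 - min p (1/2))"
  have s: "0 < s" "s < 1"
    using p(1) by (auto simp: s_def min_def)
  have s2: "s ^ 2 = 1 - min p (1/2)"
    using p(1) by (simp add: s_def)
  define c1 where "c1 = - ln s"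
  have c1: "c1 > 0"
    using s by (simp add: c1_def)
  have exp_c1: "exp (- c1 * real d) = s ^ d" for d
    using s by (simp add: c1_def exp_of_nat_mult exp_of_nat2_mult)
  have lim: "(\<lambda>d. s ^ d) \<longlonglongrightarrow> 0"
    using s by (intro LIMSEQ_realpow_zero) auto
  let ?V = "\<lambda>d \<omega>. \<lambda>b\<in>{..<d}. Us b \<omega>" and ?P = "\<lambda>d :: nat. PiM {..<d} (\<lambda>_. borel :: (real ^ 'n) measure)"
  note iv = indep_vars_split_first[OF assms(1) indep]
  have rvU [measurable]: "random_variable borel U"
    by (rule iv(1))
  have rvUs [measurable]: "random_variable borel (Us b)" for b
    using indep_vars_reindex_case_option[OF assms(1) indep, of UNIV] by (auto simp: indep_vars_def)
  let ?A = "{\<omega> \<in> space M. U \<omega> \<in> A}"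
  define miss where "miss d = {\<omega> \<in> space M. U \<omega> \<in> A \<and> (\<forall>b<d. (U \<omega>, Us b \<omega>) \<notin> Z)}" for d
  have [measurable]: "miss d \<in> events" "E d \<in> events" "?A \<in> events" for d
    unfolding miss_def E_def by measurable
  have miss: "prob (miss d) \<le> s ^ d * s ^ d" for d
  proof -
    have "prob (miss d) \<le> (s ^ 2) ^ d"
      unfolding miss_def
    proof (rule prob_all_miss_le[OF assms(1) indep Us A Z])
      show "1 - s ^ 2 \<le> measure \<nu> (Pair u -` Z)" if "u \<in> A" for u
        using p(2)[OF that] by (simp add: s2)
    qed simp
    then show ?thesis
      by (simp add: power_mult[symmetric] power_mult_distrib[symmetric] power2_eq_square)
  qed
  have incl: "?A - miss d \<subseteq> E d" for d
    using AA by (auto simp: miss_def E_def)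
  have "\<exists>r. r \<in> o(\<lambda>d. exp (- c1 * real d)) \<and> (\<forall>d. measure M (E d) \<ge> c - r d)"
  proof (intro exI[of _ "\<lambda>d. s ^ d * s ^ d"] conjI allI)
    show "(\<lambda>d. s ^ d * s ^ d) \<in> o(\<lambda>d. exp (- c1 * real d))"
      unfolding exp_c1 using s lim by (intro smalloI_tendsto) auto
    fix d
    have "c - s ^ d * s ^ d \<le> prob ?A - prob (miss d)"
      using c miss[of d] by simp
    also have "\<dots> = prob (?A - miss d)"
      by (rule finite_measure_Diff[symmetric]) (auto simp: miss_def)
    also have "\<dots> \<le> prob (E d)"
      by (rule finite_measure_mono[OF incl]) measurable
    finally show "c - s ^ d * s ^ d \<le> prob (E d)" .
  qed
  moreover have "\<exists>R. (\<forall>d. R d \<in> borel_measurable (gen_sigma M d Us)) \<and>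
          small_op M R (\<lambda>d. exp (- c1 * real d)) \<and>
          (\<forall>d. AE \<omega> in M. cond_prob_given M (gen_sigma M d Us) (E d) \<omega> \<ge> c - R d \<omega>)"
  proof -
    let ?G = "\<lambda>d. gen_sigma M d Us"
    have sub: "subalgebra M (?G d)" for d
    proof -
      have V: "?V d \<in> measurable M (?P d)"
        by (rule iv(2))
      have "sets (?G d) = {?V d -` B \<inter> space M | B. B \<in> sets (?P d)}"
        unfolding gen_sigma_def by (rule sets_vimage_algebra2) (use measurable_space[OF V] in auto)
      then show ?thesis
        using V by (auto simp: subalgebra_def gen_sigma_def measurable_sets)
    qed
    have fms: "finite_measure_subalgebra M (?G d)" for d
      by unfold_locales (rule sub)
    \<comment> \<open>The conditional probability of a miss, whose mean is the unconditional
      one.\<close>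
    define R where "R d = real_cond_exp M (?G d) (indicator (miss d))" for d
    have R0: "AE \<omega> in M. 0 \<le> R d \<omega>" and Rint: "integrable M (R d)" "(\<integral>\<omega>. R d \<omega> \<partial>M) = prob (miss d)" for d
    proof -
      interpret finite_measure_subalgebra M "?G d" by (rule fms)
      have "integrable M (indicator (miss d) :: _ \<Rightarrow> real)"
        by (simp add: less_top[symmetric])
      from real_cond_exp_int[OF this] show "integrable M (R d)" "(\<integral>\<omega>. R d \<omega> \<partial>M) = prob (miss d)"
        by (simp_all add: R_def miss_def Int_absorb1 subset_eq)
      show "AE \<omega> in M. 0 \<le> R d \<omega>"
        unfolding R_def by (rule real_cond_exp_pos) auto
    qed
    have Rmeas [measurable]: "R d \<in> borel_measurable M" for d
      by (rule borel_measurable_integrable[OF Rint(1)])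
    show ?thesis
    proof (intro exI[of _ R] conjI allI)
      show "R d \<in> borel_measurable (?G d)" for d
        unfolding R_def by (rule borel_measurable_cond_exp)
      show "small_op M R (\<lambda>d. exp (- c1 * real d))"
        unfolding small_op_def exp_c1
      proof (intro allI impI)
        fix \<epsilon> :: real assume \<epsilon>: "\<epsilon> > 0"
        show "(\<lambda>d. prob {\<omega> \<in> space M. \<epsilon> * s ^ d < \<bar>R d \<omega>\<bar>}) \<longlonglongrightarrow> 0"
        proof (rule tendsto_sandwich[OF _ _ tendsto_const])
          show "(\<lambda>d. s ^ d / \<epsilon>) \<longlonglongrightarrow> 0"
            using tendsto_divide[OF lim tendsto_const, of \<epsilon>] \<epsilon> by simp
          \<comment> \<open>Markov's inequality for \<open>R d\<close>, which is almost everywhere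
            nonnegative.\<close>
          have "prob {\<omega> \<in> space M. \<epsilon> * s ^ d < \<bar>R d \<omega>\<bar>} \<le> s ^ d / \<epsilon>" for d
          proof -
            have pos: "0 < \<epsilon> * s ^ d" using \<epsilon> s by simp
            have "prob {\<omega> \<in> space M. \<epsilon> * s ^ d < \<bar>R d \<omega>\<bar>} \<le> prob {\<omega> \<in> space M. \<epsilon> * s ^ d \<le> R d \<omega>}"
              by (rule finite_measure_mono_AE) (use R0[of d] in auto)
            also have "\<dots> \<le> (\<integral>\<omega>. R d \<omega> \<partial>M) / (\<epsilon> * s ^ d)"
              by (rule integral_Markov_inequality_measure[where A = "{}"]) (use Rint R0 pos in auto)
            also have "\<dots> \<le> (s ^ d * s ^ d) / (\<epsilon> * s ^ d)"
              unfolding Rint using miss pos by (intro divide_right_mono) auto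
            also have "\<dots> = s ^ d / \<epsilon>"
              using s by simp
            finally show ?thesis .
          qed
          then show "\<forall>\<^sub>F d in sequentially. prob {\<omega> \<in> space M. \<epsilon> * s ^ d < \<bar>R d \<omega>\<bar>} \<le> s ^ d / \<epsilon>"
            by simp
        qed simp
      qed
      fix d
      interpret finite_measure_subalgebra M "?G d" by (rule fms)
      let ?iA = "indicator ?A :: 'a \<Rightarrow> real" and ?im = "indicator (miss d) :: 'a \<Rightarrow> real"
      have int: "integrable M ?iA" "integrable M ?im" "integrable M (indicator (E d) :: 'a \<Rightarrow> real)"
        by (simp_all add: less_top[symmetric])
      \<comment> \<open>The true noise is independent of the copies, so conditioning on them leaves
        a constant. Subtracting the conditional miss probability bounds that of \<open>E d\<close>
        from below.\<close>
      have "AE \<omega> in M. real_cond_exp M (?G d) ?iA \<omega> = prob ?A"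
        by (rule real_cond_exp_indicator_indep[OF assms(1) iv A]) (simp add: gen_sigma_def)
      moreover have "AE \<omega> in M. real_cond_exp M (?G d) (\<lambda>\<omega>. ?iA \<omega> - ?im \<omega>) \<omega>
          = real_cond_exp M (?G d) ?iA \<omega> - real_cond_exp M (?G d) ?im \<omega>"
        by (rule real_cond_exp_diff) (rule int)+
      moreover have "AE \<omega> in M. real_cond_exp M (?G d) (\<lambda>\<omega>. ?iA \<omega> - ?im \<omega>) \<omega>
          \<le> real_cond_exp M (?G d) (indicator (E d)) \<omega>"
      proof (rule real_cond_exp_mono)
        show "AE \<omega> in M. ?iA \<omega> - ?im \<omega> \<le> indicator (E d) \<omega>"
          using incl[of d] by (intro AE_I2) (auto simp: indicator_def)
      qed (use int in auto)
      ultimately show "AE \<omega> in M. cond_prob_given M (?G d) (E d) \<omega> \<ge> c - R d \<omega>"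
        unfolding cond_prob_given_def R_def by eventually_elim (use c in linarith)
    qed
  qed
  ultimately show ?thesis
    using c1 by blast
qed

section \<open>Candidates near the true noise\<close>

text \<open>Continuity from below along the thresholds \<open>1 / (j + 1)\<close>; the strict
  inequality for the union already holds at some finite stage. It serves both the signal gap and the
  hit probability.\<close>

lemma (in finite_measure) ex_threshold:
  fixes A :: "real \<Rightarrow> 'a set"
  assumes A: "\<And>\<epsilon>. A \<epsilon> \<in> sets M" and mono: "\<And>\<epsilon> \<epsilon>'. \<epsilon> \<le> \<epsilon>' \<Longrightarrow> A \<epsilon>' \<subseteq> A \<epsilon>"
    and c: "c < measure M (\<Union>\<epsilon>\<in>{0<..}. A \<epsilon>)"
  obtains \<epsilon> where "\<epsilon> > 0" "c < measure M (A \<epsilon>)"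
proof -
  let ?B = "\<lambda>j::nat. A (1 / real (Suc j))"
  have "(\<Union>\<epsilon>\<in>{0<..}. A \<epsilon>) = (\<Union>j. ?B j)"
  proof
    show "(\<Union>\<epsilon>\<in>{0<..}. A \<epsilon>) \<subseteq> (\<Union>j. ?B j)"
    proof
      fix x assume "x \<in> (\<Union>\<epsilon>\<in>{0<..}. A \<epsilon>)"
      then obtain \<epsilon> where "\<epsilon> > 0" "x \<in> A \<epsilon>" by auto
      moreover from \<open>\<epsilon> > 0\<close> obtain j where "1 / real (Suc j) < \<epsilon>"
        by (metis nat_approx_posE)
      ultimately show "x \<in> (\<Union>j. ?B j)"
        using mono[of "1 / real (Suc j)" \<epsilon>] by auto
    qed
    show "(\<Union>j. ?B j) \<subseteq> (\<Union>\<epsilon>\<in>{0<..}. A \<epsilon>)"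
      by (intro UN_least UN_upper) simp
  qed
  moreover have "incseq ?B"
    by (intro incseq_SucI mono) (simp add: frac_le)
  then have "(\<lambda>j. measure M (?B j)) \<longlonglongrightarrow> measure M (\<Union>j. ?B j)"
    using A by (intro finite_Lim_measure_incseq) auto
  ultimately have "\<forall>\<^sub>F j in sequentially. c < measure M (?B j)"
    using c by (intro order_tendstoD) auto
  then obtain j where "c < measure M (?B j)"
    by (auto dest: eventually_happens)
  then show ?thesis
    by (intro that[of "1 / real (Suc j)"]) auto
qed

lemma null_sets_std_gaussian: "N \<in> null_sets lborel \<Longrightarrow> N \<in> null_sets std_gaussian"
  unfolding std_gaussian_def
  using absolutely_continuousI_density[of "\<lambda>x. ennreal (\<Prod>i\<in>UNIV. std_normal_density (x $ i))" lborel]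
  by (auto simp: absolutely_continuous_def)

text \<open>The density is positive everywhere, so an open set without Gaussian mass would be
  Lebesgue null.\<close>

lemma emeasure_std_gaussian_open:
  fixes S :: "(real ^ 'n) set"
  assumes S: "open S" "S \<noteq> {}"
  shows "emeasure std_gaussian S > 0"
proof (rule ccontr)
  let ?g = "\<lambda>x :: real ^ 'n. ennreal ((1 / sqrt (2 * pi)) ^ CARD('n) * exp (- (norm x)\<^sup>2 / 2))"
  assume "\<not> emeasure std_gaussian S > 0"
  then have "(\<integral>\<^sup>+x. ?g x * indicator S x \<partial>lborel) = 0"
    using S(1) by (simp add: std_gaussian_eq_density_norm emeasure_density)
  then have "AE x in lborel. ?g x * indicator S x = 0"
    using S(1) by (subst (asm) nn_integral_0_iff_AE) auto
  then have "AE x in lborel. x \<notin> S"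
    by eventually_elim (auto simp: indicator_def split: if_splits)
  then have "S \<in> null_sets lborel"
    using S(1) by (subst (asm) AE_iff_null_sets[symmetric]) auto
  then have "negligible S"
    by (simp add: negligible_iff_null_sets null_sets_completionI)
  then show False
    using open_not_negligible[OF S] by simp
qed

text \<open>The infimum is tested at the true coefficients and the true scale \<sigma>0, where only
  the difference of the two noise vectors remains.\<close>

lemma cand_obj_at_response_le:
  assumes lam: "lam \<ge> 0" and \<beta>: "\<beta> \<in> coeff_space \<tau>"
  shows "cand_obj X lam (response X \<tau> \<beta> \<sigma>0 u) v \<tau> \<le> (norm (\<sigma>0 *\<^sub>R u - \<sigma>0 *\<^sub>R v))\<^sup>2 + lam * real (card \<tau>)"
proof -
  let ?y = "response X \<tau> \<beta> \<sigma>0 u"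
  let ?f = "\<lambda>(\<beta>, \<sigma>). (norm (?y - model_mean X \<tau> \<beta> - \<sigma> *\<^sub>R v))\<^sup>2 + lam * real (card \<tau>)"
  have "cand_obj X lam ?y v \<tau> \<le> ?f (\<beta>, \<sigma>0)"
    unfolding cand_obj_def
  proof (rule cINF_lower)
    show "bdd_below (?f ` (coeff_space \<tau> \<times> UNIV))"
      using lam by (intro bdd_belowI[of _ 0]) auto
  qed (use \<beta> in auto)
  then show ?thesis by (simp add: response_def)
qed

text \<open>The fit part of the objective is nonnegative by Cauchy-Schwarz. For models larger than
  the true one the penalty alone will then be decisive.\<close>

lemma cand_obj_ge: "cand_obj X lam y v \<tau> \<ge> lam * real (card \<tau>)"
proof -
  have "(resid X \<tau> y \<bullet> resid X \<tau> v)\<^sup>2 / (norm (resid X \<tau> v))\<^sup>2 \<le> (norm (resid X \<tau> y))\<^sup>2"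
  proof (cases "resid X \<tau> v = 0")
    case False
    then show ?thesis
      using Cauchy_Schwarz_ineq[of "resid X \<tau> y" "resid X \<tau> v"]
      by (simp add: divide_le_eq power2_norm_eq_inner)
  qed simp
  then show ?thesis
    by (simp add: cand_obj_eq)
qed

text \<open>
  The squared distance of the true mean from the span of the columns in \<open>\<tau>\<close> together with the noise \<open>u\<close>.
\<close>

definition signal_gap :: "real ^ 'p ^ 'n \<Rightarrow> real ^ 'n \<Rightarrow> 'p set \<Rightarrow> real ^ 'n \<Rightarrow> real" where
  "signal_gap X \<mu> \<tau> u = (norm (resid X \<tau> \<mu>))\<^sup>2 - (resid X \<tau> \<mu> \<bullet> resid X \<tau> u)\<^sup>2 / (norm (resid X \<tau> u))\<^sup>2"

lemma measurable_signal_gap [measurable]: "signal_gap X \<mu> \<tau> \<in> borel_measurable borel"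
  unfolding signal_gap_def[abs_def] by measurable

text \<open>The fit part is a squared distance from a subspace containing \<open>u\<close>, which
  adding a multiple of \<open>u\<close> to the mean does not change.\<close>

lemma cand_obj_at_same_noise:
  assumes "resid X \<tau> u \<noteq> 0"
  shows "cand_obj X lam (\<mu> + \<sigma> *\<^sub>R u) u \<tau> = signal_gap X \<mu> \<tau> u + lam * real (card \<tau>)"
proof -
  define a b c where "a = resid X \<tau> \<mu> \<bullet> resid X \<tau> \<mu>" and "b = resid X \<tau> \<mu> \<bullet> resid X \<tau> u"
    and "c = resid X \<tau> u \<bullet> resid X \<tau> u"
  have "c \<noteq> 0" using assms by (simp add: c_def)
  then have "a + 2 * \<sigma> * b + \<sigma>\<^sup>2 * c - (b + \<sigma> * c)\<^sup>2 / c = a - b\<^sup>2 / c"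
    by (simp add: field_simps power2_eq_square)
  moreover have "resid X \<tau> (\<mu> + \<sigma> *\<^sub>R u) = resid X \<tau> \<mu> + \<sigma> *\<^sub>R resid X \<tau> u"
    by (simp add: linear_add[OF linear_resid] linear_cmul[OF linear_resid])
  ultimately show ?thesis
    unfolding cand_obj_eq signal_gap_def power2_norm_eq_inner
    by (simp add: inner_add_left inner_add_right inner_commute a_def b_def c_def power2_eq_square algebra_simps)
qed

lemma eventually_tau_hat_eq:
  fixes X :: "real ^ 'p ^ 'n"
  assumes sel: "tie_rule sel" and \<beta>0: "\<beta>0 \<in> coeff_space \<tau>0" and lam: "lam > 0"
    and gap: "\<And>\<tau>. \<tau> \<noteq> \<tau>0 \<Longrightarrow> card \<tau> \<le> card \<tau>0 \<Longrightarrow>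
      resid X \<tau> u \<noteq> 0 \<and> signal_gap X (model_mean X \<tau>0 \<beta>0) \<tau> u > lam * real (card \<tau>0)"
  shows "\<forall>\<^sub>F v in nhds u. tau_hat sel X lam (response X \<tau>0 \<beta>0 \<sigma>0 u) v = \<tau>0"
proof -
  let ?y = "response X \<tau>0 \<beta>0 \<sigma>0 u"
  \<comment> \<open>A continuous majorant of the objective of the true model, which spares a
    discussion of the quotient in \<open>cand_obj_eq\<close> for that model.\<close>
  let ?up = "\<lambda>v. (norm (\<sigma>0 *\<^sub>R u - \<sigma>0 *\<^sub>R v))\<^sup>2 + lam * real (card \<tau>0)"
  have id: "((\<lambda>v. v) \<longlongrightarrow> u) (nhds u)"
    by (rule filterlim_ident)
  have up: "(?up \<longlongrightarrow> lam * real (card \<tau>0)) (nhds u)"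
    by (rule tendsto_eq_intros id refl | simp)+
  have "\<forall>\<^sub>F v in nhds u. \<tau> \<noteq> \<tau>0 \<longrightarrow> cand_obj X lam ?y v \<tau>0 < cand_obj X lam ?y v \<tau>" for \<tau>
  proof (cases "\<tau> = \<tau>0")
    case neq: False
    have "\<forall>\<^sub>F v in nhds u. ?up v < cand_obj X lam ?y v \<tau>"
    proof (cases "card \<tau> \<le> card \<tau>0")
      case True
      note g = gap[OF neq True]
      have R: "((\<lambda>v. resid X \<tau> v) \<longlongrightarrow> resid X \<tau> u) (nhds u)"
        by (rule bounded_linear.tendsto[OF linear_conv_bounded_linear[THEN iffD1, OF linear_resid] id])
      have "((\<lambda>v. cand_obj X lam ?y v \<tau>) \<longlongrightarrow> cand_obj X lam ?y u \<tau>) (nhds u)"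
        unfolding cand_obj_eq using g by (intro tendsto_intros R) auto
      from tendsto_diff[OF this up]
      have "((\<lambda>v. cand_obj X lam ?y v \<tau> - ?up v) \<longlongrightarrow> cand_obj X lam ?y u \<tau> - lam * real (card \<tau>0)) (nhds u)" .
      moreover have "cand_obj X lam ?y u \<tau> - lam * real (card \<tau>0) > 0"
      proof -
        have "0 \<le> lam * real (card \<tau>)" using lam by simp
        then show ?thesis
          using g unfolding response_def by (subst cand_obj_at_same_noise) auto
      qed
      ultimately have "\<forall>\<^sub>F v in nhds u. 0 < cand_obj X lam ?y v \<tau> - ?up v"
        by (rule order_tendstoD)
      then show ?thesis by eventually_elim linarith
    next
      case False
      then have "lam * real (card \<tau>0) < lam * real (card \<tau>)"
        using lam by simp
      with up have "\<forall>\<^sub>F v in nhds u. ?up v < lam * real (card \<tau>)"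
        by (rule order_tendstoD)
      then show ?thesis
        by eventually_elim (rule less_le_trans[OF _ cand_obj_ge])
    qed
    then show ?thesis
      by eventually_elim (use cand_obj_at_response_le[OF less_imp_le[OF lam] \<beta>0] in \<open>blast intro: le_less_trans\<close>)
  qed simp
  then have "\<forall>\<^sub>F v in nhds u. \<forall>\<tau>. \<tau> \<noteq> \<tau>0 \<longrightarrow> cand_obj X lam ?y v \<tau>0 < cand_obj X lam ?y v \<tau>"
    by (intro eventually_all_finite) auto
  then show ?thesis
  proof eventually_elim
    case (elim v)
    \<comment> \<open>Strict comparison with every other model leaves a single minimizer, so the
      tie-breaking rule has no choice.\<close>
    have "{\<tau>. is_arg_min (cand_obj X lam ?y v) (\<lambda>_. True) \<tau>} = {\<tau>0}"
    proof -
      have "is_arg_min (cand_obj X lam ?y v) (\<lambda>_. True) \<tau> \<longleftrightarrow> \<tau> = \<tau>0" for \<tau>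
        unfolding is_arg_min_def using elim by (metis less_asym less_irrefl)
      then show ?thesis by auto
    qed
    then show ?case
      using sel unfolding tau_hat_def tie_rule_def by (metis insert_not_empty singletonD)
  qed
qed

text \<open>The gap can fail to be positive only under equality in Cauchy-Schwarz, when the
  residuals of \<mu> and \<open>u\<close> are parallel. Then \<open>u\<close> lies in the span of
  \<mu> and the columns, a subspace of dimension at most \<open>card \<tau> + 1\<close>, hence
  null.\<close>

lemma AE_signal_gap_pos:
  fixes X :: "real ^ 'p ^ 'n"
  assumes \<mu>: "\<mu> \<notin> column_span X \<tau>" and dim: "card \<tau> + 1 < CARD('n)"
  shows "AE u in std_gaussian. resid X \<tau> u \<noteq> 0 \<and> signal_gap X \<mu> \<tau> u > 0"
proof -
  let ?S = "span (insert \<mu> ((\<lambda>j. column j X) ` \<tau>))"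
  have sub: "column_span X \<tau> \<subseteq> ?S"
    unfolding column_span_def by (rule span_mono) auto
  have "dim (insert \<mu> ((\<lambda>j. column j X) ` \<tau>)) \<le> card (insert \<mu> ((\<lambda>j. column j X) ` \<tau>))"
    by (rule dim_le_card') simp
  also have "\<dots> \<le> card \<tau> + 1"
    using card_image_le[of \<tau> "\<lambda>j. column j X"] by (simp add: card_insert_if)
  finally have "negligible ?S"
    using dim by (intro negligible_lowdim) simp
  then have "?S \<in> null_sets lebesgue"
    by (simp add: negligible_iff_null_sets)
  moreover have "?S \<in> sets borel"
    by (intro borel_closed closed_subspace subspace_span)
  ultimately have "?S \<in> null_sets lborel"
    by (simp add: null_sets_def)
  then have "AE u in std_gaussian. u \<notin> ?S"
    by (intro AE_not_in null_sets_std_gaussian)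
  then show ?thesis
  proof eventually_elim
    case (elim u)
    have Ru: "resid X \<tau> u \<noteq> 0"
      using elim sub by (auto simp: resid_eq_0_iff)
    have "signal_gap X \<mu> \<tau> u > 0"
    proof (rule ccontr)
      let ?r = "resid X \<tau> \<mu>" and ?s = "resid X \<tau> u"
      assume "\<not> signal_gap X \<mu> \<tau> u > 0"
      then have "(norm ?r)\<^sup>2 * (norm ?s)\<^sup>2 \<le> (?r \<bullet> ?s)\<^sup>2"
        using Ru by (simp add: signal_gap_def not_less pos_le_divide_eq)
      then have "norm ?r * norm ?s \<le> \<bar>?r \<bullet> ?s\<bar>"
        by (simp add: power_mult_distrib[symmetric] abs_le_square_iff[symmetric] abs_mult)
      then have "\<bar>?r \<bullet> ?s\<bar> = norm ?r * norm ?s"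
        using Cauchy_Schwarz_ineq2[of ?r ?s] by linarith
      then have "norm ?r *\<^sub>R ?s = norm ?s *\<^sub>R ?r \<or> norm ?r *\<^sub>R ?s = - norm ?s *\<^sub>R ?r"
        by (simp add: norm_cauchy_schwarz_abs_eq)
      then obtain c where c: "norm ?r *\<^sub>R ?s = c *\<^sub>R ?r" by metis
      \<comment> \<open>Since \<mu> is outside the column span, its residual is nonzero and the
        linear relation can be solved for the residual of \<open>u\<close>.\<close>
      have r0: "?r \<noteq> 0"
        using \<mu> by (simp add: resid_eq_0_iff)
      have "?r \<in> ?S"
        unfolding resid_eq using sub proj_mat_in_column_span by (intro span_diff) (auto intro: span_base)
      then have "(1 / norm ?r) *\<^sub>R (c *\<^sub>R ?r) \<in> ?S"
        by (intro span_scale)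
      then have "?s \<in> ?S"
        using r0 by (simp add: c[symmetric])
      then have "?s + proj_mat X \<tau> *v u \<in> ?S"
        using sub proj_mat_in_column_span by (intro span_add) auto
      with elim show False
        by (simp add: resid_eq)
    qed
    with Ru show ?case by blast
  qed
qed

lemma ex_signal_gap_threshold:
  fixes X :: "real ^ 'p ^ 'n"
  assumes id: "identifiable X \<tau>0 \<beta>0" and n: "card \<tau>0 + 1 < CARD('n)" and \<delta>: "\<delta> > 0"
  obtains \<epsilon> where "\<epsilon> > 0"
    "1 - \<delta> < measure std_gaussian {u. \<forall>\<tau>\<in>{\<tau>. \<tau> \<noteq> \<tau>0 \<and> card \<tau> \<le> card \<tau>0}.
      resid X \<tau> u \<noteq> 0 \<and> signal_gap X (model_mean X \<tau>0 \<beta>0) \<tau> u > \<epsilon>}"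
proof -
  interpret G: prob_space "std_gaussian :: (real ^ 'n) measure" by (rule prob_space_std_gaussian)
  let ?S = "{\<tau>. \<tau> \<noteq> \<tau>0 \<and> card \<tau> \<le> card \<tau>0}" and ?g = "signal_gap X (model_mean X \<tau>0 \<beta>0)"
  define D where "D \<epsilon> = {u. \<forall>\<tau>\<in>?S. resid X \<tau> u \<noteq> 0 \<and> ?g \<tau> u > \<epsilon>}" for \<epsilon>
  have D_sets: "D \<epsilon> \<in> sets std_gaussian" for \<epsilon>
  proof -
    have "D \<epsilon> = {u \<in> space borel. \<forall>\<tau>\<in>?S. resid X \<tau> u \<noteq> 0 \<and> ?g \<tau> u > \<epsilon>}"
      by (simp add: D_def)
    also have "\<dots> \<in> sets borel" by measurable
    finally show ?thesis by simp
  qed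
  have "AE u in std_gaussian. \<forall>\<tau>\<in>?S. resid X \<tau> u \<noteq> 0 \<and> ?g \<tau> u > 0"
  proof (subst AE_finite_all)
    show "\<forall>\<tau>\<in>?S. AE u in std_gaussian. resid X \<tau> u \<noteq> 0 \<and> ?g \<tau> u > 0"
      using identifiable_not_in_column_span[OF id] n by (intro ballI AE_signal_gap_pos) auto
  qed simp
  then have "AE u in std_gaussian. u \<in> D 0"
    by (simp add: D_def)
  then have "G.prob (D 0) = 1"
    using D_sets by (simp add: G.prob_eq_1)
  moreover have "(\<Union>\<epsilon>\<in>{0<..}. D \<epsilon>) = D 0"
  proof
    show "(\<Union>\<epsilon>\<in>{0<..}. D \<epsilon>) \<subseteq> D 0"
      unfolding D_def using less_trans by fastforce
    show "D 0 \<subseteq> (\<Union>\<epsilon>\<in>{0<..}. D \<epsilon>)"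
    proof
      fix u assume u: "u \<in> D 0"
      \<comment> \<open>The extra 1 keeps the set nonempty whatever the competing models are; half
        of \<open>m\<close> will give the strict inequality.\<close>
      define m where "m = Min (insert 1 ((\<lambda>\<tau>. ?g \<tau> u) ` ?S))"
      have "m > 0"
        unfolding m_def using u by (subst Min_gr_iff) (auto simp: D_def)
      moreover have "m \<le> ?g \<tau> u" if "\<tau> \<in> ?S" for \<tau>
        unfolding m_def using that by (intro Min_le) auto
      ultimately have "u \<in> D (m / 2)"
        using u unfolding D_def by force
      then show "u \<in> (\<Union>\<epsilon>\<in>{0<..}. D \<epsilon>)"
        using \<open>m > 0\<close> by (intro UN_I[of "m / 2"]) auto
    qed
  qed
  ultimately have "1 - \<delta> < G.prob (\<Union>\<epsilon>\<in>{0<..}. D \<epsilon>)"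
    using \<delta> by simp
  moreover have "D \<epsilon>' \<subseteq> D \<epsilon>" if "\<epsilon> \<le> \<epsilon>'" for \<epsilon> \<epsilon>'
    unfolding D_def using le_less_trans[OF that] by blast
  ultimately obtain \<epsilon> where "\<epsilon> > 0" "1 - \<delta> < G.prob (D \<epsilon>)"
    using G.ex_threshold[of D "1 - \<delta>"] D_sets by blast
  then show ?thesis
    unfolding D_def by (rule that)
qed

lemma tau_hat_hit_prob_pos:
  fixes X :: "real ^ 'p ^ 'n"
  assumes "tie_rule sel" "\<beta>0 \<in> coeff_space \<tau>0" "lam > 0"
    and "\<And>\<tau>. \<tau> \<noteq> \<tau>0 \<Longrightarrow> card \<tau> \<le> card \<tau>0 \<Longrightarrow>
      resid X \<tau> u \<noteq> 0 \<and> signal_gap X (model_mean X \<tau>0 \<beta>0) \<tau> u > lam * real (card \<tau>0)"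
    and meas: "{v. tau_hat sel X lam (response X \<tau>0 \<beta>0 \<sigma>0 u) v = \<tau>0} \<in> sets borel"
  shows "measure std_gaussian {v. tau_hat sel X lam (response X \<tau>0 \<beta>0 \<sigma>0 u) v = \<tau>0} > 0"
proof -
  interpret G: prob_space "std_gaussian :: (real ^ 'n) measure" by (rule prob_space_std_gaussian)
  let ?H = "{v. tau_hat sel X lam (response X \<tau>0 \<beta>0 \<sigma>0 u) v = \<tau>0}"
  have "\<forall>\<^sub>F v in nhds u. v \<in> ?H"
    using eventually_tau_hat_eq[OF assms(1-4)] by simp
  then obtain S where S: "open S" "u \<in> S" "S \<subseteq> ?H"
    unfolding eventually_nhds by blast
  have "0 < emeasure std_gaussian S"
    using S by (intro emeasure_std_gaussian_open) auto
  also have "\<dots> \<le> emeasure std_gaussian ?H"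
    using S(3) meas by (intro emeasure_mono) auto
  finally show ?thesis
    by (simp add: G.emeasure_eq_measure)
qed

section \<open>Choice of the constants and assembly of the coverage bound\<close>

theorem theorem14:
  fixes X :: "real ^ 'p ^ 'n"
    and \<tau>0 :: "'p set" and \<beta>0 :: "real ^ 'p" and \<sigma>0 :: real
    and sel selT :: "'p set set \<Rightarrow> 'p set"
    and M :: "'a measure"
    and U :: "'a \<Rightarrow> real ^ 'n" and Us :: "nat \<Rightarrow> 'a \<Rightarrow> real ^ 'n"
    and \<alpha>1 \<alpha>2 \<alpha> \<delta> :: real
  assumes "\<tau>0 \<noteq> {}" and "\<beta>0 \<in> coeff_space \<tau>0" and "\<sigma>0 > 0"
    and "identifiable X \<tau>0 \<beta>0"
    and "tie_rule sel" and "tie_rule selT"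
    and "prob_space M"
    and "prob_space.indep_vars M (\<lambda>_. borel) (case_option U Us) UNIV"
    and "distr M borel U = std_gaussian"
    and "\<And>b. distr M borel (Us b) = std_gaussian"
    and "\<alpha>1 \<in> {1/2<..<1}" and "\<alpha>2 \<in> {1/2<..<1}" and "\<alpha>1 + \<alpha>2 - 1 = \<alpha>"
    and "real CARD('n) - real (card \<tau>0) > 4"
    and "\<delta> > 0"
  shows "\<exists>\<gamma>\<in>{0<..<1}. \<forall>lam>0.
    lam \<in> {4 * real CARD('n) * \<gamma> powr (1/2)
             * (2 + 2 * (real (card \<tau>0) + 1) * (ln (real CARD('p) / 2) / real CARD('n))) * \<sigma>0\<^sup>2
           .. real CARD('n) * \<gamma> powr (1/4) / 6 * C_min X \<tau>0 \<beta>0} \<longrightarrow>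
    (let E = (\<lambda>d. {\<omega> \<in> space M. (\<tau>0, \<beta>0) \<in>
                joint_conf_set sel selT X lam \<alpha>1 \<alpha>2 d (\<lambda>b. Us b \<omega>) (response X \<tau>0 \<beta>0 \<sigma>0 (U \<omega>))})
     in \<exists>c1>0.
       (\<exists>r. r \<in> o(\<lambda>d. exp (- c1 * real d)) \<and>
          (\<forall>d. measure M (E d) \<ge> \<alpha> - \<delta> - r d)) \<and>
       (\<exists>R. (\<forall>d. R d \<in> borel_measurable (gen_sigma M d Us)) \<and>
          small_op M R (\<lambda>d. exp (- c1 * real d)) \<and>
          (\<forall>d. AE \<omega> in M. cond_prob_given M (gen_sigma M d Us) (E d) \<omega> \<ge> \<alpha> - \<delta> - R d \<omega>)))"
proof -
  interpret prob_space M by fact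
  interpret G: prob_space "std_gaussian :: (real ^ 'n) measure" by (rule prob_space_std_gaussian)
  let ?k = "card \<tau>0" and ?n = "real CARD('n)" and ?C = "C_min X \<tau>0 \<beta>0"
  let ?y = "response X \<tau>0 \<beta>0 \<sigma>0"
  have kn: "?k + 1 < CARD('n)"
    using assms(14) by linarith
  obtain \<epsilon> where \<epsilon>: "\<epsilon> > 0"
    "1 - \<delta> < G.prob {u. \<forall>\<tau>\<in>{\<tau>. \<tau> \<noteq> \<tau>0 \<and> card \<tau> \<le> card \<tau>0}.
      resid X \<tau> u \<noteq> 0 \<and> signal_gap X (model_mean X \<tau>0 \<beta>0) \<tau> u > \<epsilon>}" (is "_ < G.prob ?D")
    by (rule ex_signal_gap_threshold[OF assms(4) kn \<open>\<delta> > 0\<close>])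
  \<comment> \<open>\<open>t * K\<close> will dominate the upper end of the interval for
    \<open>lam\<close> times the size of the true model; the absolute value makes \<open>K\<close>
    nonnegative at once.\<close>
  define K where "K = \<bar>?n / 6 * ?C * real ?k\<bar>"
  \<comment> \<open>\<open>t\<close> is \<open>\<gamma> powr (1/4)\<close>, chosen so that the upper bound on \<open>lam\<close> gives \<open>lam * ?k \<le> t * K \<le> \<epsilon>\<close>.\<close>
  define t where "t = min (1/2) (\<epsilon> / (1 + K))"
  have K: "K \<ge> 0" by (simp add: K_def)
  have t: "0 < t" "t < 1" "t * K \<le> \<epsilon>"
  proof -
    show "0 < t" "t < 1" using \<epsilon> K by (auto simp: t_def)
    have "t * K \<le> (\<epsilon> / (1 + K)) * K"
      using K by (intro mult_right_mono) (auto simp: t_def)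
    also have "\<dots> \<le> \<epsilon>"
      using \<epsilon> K by (simp add: field_simps)
    finally show "t * K \<le> \<epsilon>" .
  qed
  have t4: "(t ^ 4) powr (1/4) = t"
  proof -
    have "t ^ 4 = t powr 4"
      using t(1) by simp
    then show ?thesis
      using t(1) by (simp only: powr_powr) simp
  qed
  define A1 where "A1 = {u. T0 selT X (?y u) \<tau>0 \<in> B_model selT X \<alpha>1 \<tau>0 (W_stat X (?y u) \<tau>0)}"
  define A2 where "A2 = {u. T_stat X (?y u) \<tau>0 \<beta>0 \<in> B_coeff CARD('n) \<alpha>2 \<tau>0}"
  have A1 [measurable]: "A1 \<in> sets borel"
    unfolding A1_def by measurable
  have A2 [measurable]: "A2 \<in> sets borel"
    using measurable_sets[OF measurable_T_stat_response[of \<sigma>0 X \<tau>0 \<beta>0], of "B_coeff CARD('n) \<alpha>2 \<tau>0"] assms(3)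
    by (simp add: A2_def vimage_def B_coeff_def)
  \<comment> \<open>Bonferroni's inequality: it yields the level
    \<open>\<alpha>1 + \<alpha>2 - 1\<close> here and the loss of \<delta> later.\<close>
  have inter: "G.prob (S \<inter> T) \<ge> G.prob S + G.prob T - 1" if "S \<in> sets borel" "T \<in> sets borel" for S T
    using G.finite_measure_Union'[of S T] G.finite_measure_Diff'[of T S] that G.prob_le_1[of "S \<union> T"]
    by (simp add: Int_commute)
  have "\<alpha>1 \<le> G.prob A1"
    unfolding A1_def by (rule T0_coverage[OF assms(4,3)]) (use assms(11) kn in auto)
  moreover have "\<alpha>2 \<le> G.prob A2"
    unfolding A2_def by (rule T_stat_coverage[OF assms(4)]) (use assms(3,12) in auto)
  ultimately have A12: "\<alpha> \<le> G.prob (A1 \<inter> A2)"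
    using inter[OF A1 A2] assms(13) by linarith
  show ?thesis
  proof (intro bexI[of _ "t ^ 4"] allI impI)
    show "t ^ 4 \<in> {0<..<1}"
      using t by (simp add: power_less_one_iff)
    fix lam :: real
    assume lam: "lam > 0" and interval: "lam \<in> {4 * real CARD('n) * (t ^ 4) powr (1/2)
             * (2 + 2 * (real (card \<tau>0) + 1) * (ln (real CARD('p) / 2) / real CARD('n))) * \<sigma>0\<^sup>2
           .. real CARD('n) * (t ^ 4) powr (1/4) / 6 * C_min X \<tau>0 \<beta>0}"
    have lam_le: "lam * real ?k \<le> \<epsilon>"
    proof -
      have "lam * real ?k \<le> ?n * t / 6 * ?C * real ?k"
        using interval unfolding t4 by (intro mult_right_mono) auto
      also have "\<dots> = t * (?n / 6 * ?C * real ?k)"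
        by simp
      also have "\<dots> \<le> t * K"
        using t unfolding K_def by (intro mult_left_mono) auto
      also note t(3)
      finally show ?thesis .
    qed
    define Z where "Z = {p \<in> space (borel \<Otimes>\<^sub>M borel). tau_hat sel X lam (?y (fst p)) (snd p) = \<tau>0}"
    define p where "p u = G.prob (Pair u -` Z)" for u
    have Z [measurable]: "Z \<in> sets (borel \<Otimes>\<^sub>M borel)"
    proof -
      have "(\<lambda>p. tau_hat sel X lam (?y (fst p)) (snd p)) \<in> measurable (borel \<Otimes>\<^sub>M borel) (count_space UNIV)"
      proof -
        have "(\<lambda>p. (?y (fst p), snd p)) \<in> measurable (borel \<Otimes>\<^sub>M borel) (borel \<Otimes>\<^sub>M borel)"
          by measurable
        from measurable_compose[OF this measurable_tau_hat] show ?thesis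
          by simp
      qed
      then show ?thesis
        unfolding Z_def by measurable
    qed
    have Pair_Z: "Pair u -` Z = {v. tau_hat sel X lam (?y u) v = \<tau>0}" for u
      by (simp add: Z_def space_pair_measure vimage_def)
    have [measurable]: "p \<in> borel_measurable borel"
    proof -
      have "Z \<in> sets (borel \<Otimes>\<^sub>M std_gaussian)"
        using Z by (simp cong: sets_pair_measure_cong)
      from G.measurable_emeasure_Pair[OF this] show ?thesis
        unfolding p_def[abs_def] measure_def by measurable
    qed
    \<comment> \<open>Every noise vector with a large enough gap has a positive hit probability, so
      the bound \<open>1 - \<delta>\<close> passes to the union of the sets on which
      \<open>p\<close> exceeds a threshold.\<close>
    have "?D \<subseteq> (\<Union>q\<in>{0<..}. {u. p u > q})"
    proof
      fix u assume u: "u \<in> ?D"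
      have "p u > 0"
        unfolding p_def Pair_Z
      proof (rule tau_hat_hit_prob_pos[OF assms(5,2) lam])
        show "resid X \<tau> u \<noteq> 0 \<and> lam * real (card \<tau>0) < signal_gap X (model_mean X \<tau>0 \<beta>0) \<tau> u"
          if "\<tau> \<noteq> \<tau>0" "card \<tau> \<le> card \<tau>0" for \<tau>
          using u lam_le that by force
        show "{v. tau_hat sel X lam (?y u) v = \<tau>0} \<in> sets borel"
          using sets_Pair1[OF Z, of u] by (simp add: Pair_Z)
      qed
      then show "u \<in> (\<Union>q\<in>{0<..}. {u. p u > q})"
        by (intro UN_I[of "p u / 2"]) auto
    qed
    \<comment> \<open>Written as a single level set of \<open>p\<close>, the uncountable union is
      visibly measurable.\<close>
    moreover have "(\<Union>q\<in>{0<..}. {u. p u > q}) = {u. p u > 0}"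
    proof
      show "{u. p u > 0} \<subseteq> (\<Union>q\<in>{0<..}. {u. p u > q})"
        using dense by (fastforce simp: greaterThan_def)
      show "(\<Union>q\<in>{0<..}. {u. p u > q}) \<subseteq> {u. p u > 0}"
      proof (intro UN_least subsetI)
        fix q u assume "q \<in> {0<..}" "u \<in> {u. p u > q}"
        then have "0 < q" "q < p u" by auto
        then show "u \<in> {u. p u > 0}" by simp
      qed
    qed
    ultimately have "G.prob ?D \<le> G.prob (\<Union>q\<in>{0<..}. {u. p u > q})"
      by (intro G.finite_measure_mono) simp_all
    with \<epsilon>(2) have "1 - \<delta> < G.prob (\<Union>q\<in>{0<..}. {u. p u > q})"
      by linarith
    moreover have "{u. p u > q} \<in> sets std_gaussian" for q
      by simp
    moreover have "{u. p u > q'} \<subseteq> {u. p u > q}" if "q \<le> q'" for q q'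
      using that by auto
    ultimately obtain q where q: "q > 0" "1 - \<delta> < G.prob {u. p u > q}"
      using G.ex_threshold[of "\<lambda>q. {u. p u > q}" "1 - \<delta>"] by blast
    let ?A = "A1 \<inter> A2 \<inter> {u. p u > q}"
    have "G.prob ?A \<ge> \<alpha> - \<delta>"
      using inter[of "A1 \<inter> A2" "{u. p u > q}"] A12 q(2) by simp
    moreover have "U \<in> borel_measurable M"
      using indep_vars_split_first(1)[OF assms(7,8)] .
    then have "prob {\<omega> \<in> space M. U \<omega> \<in> ?A} = G.prob ?A"
      unfolding assms(9)[symmetric] by (subst measure_distr) (auto intro!: arg_cong[of _ _ prob])
    ultimately have c: "prob {\<omega> \<in> space M. U \<omega> \<in> ?A} \<ge> \<alpha> - \<delta>"
      by simp
    \<comment> \<open>Coverage means that both statistics accept and that one of the first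
      \<open>d\<close> copies selects the true model; the first condition depends on the true noise
      only.\<close>
    have E: "{\<omega> \<in> space M. (\<tau>0, \<beta>0) \<in> joint_conf_set sel selT X lam \<alpha>1 \<alpha>2 d (\<lambda>b. Us b \<omega>) (?y (U \<omega>))}
        = {\<omega> \<in> space M. U \<omega> \<in> A1 \<inter> A2 \<and> (\<exists>b<d. (U \<omega>, Us b \<omega>) \<in> Z)}" for d
      using assms(2)
      by (auto simp: joint_conf_set_def model_conf_set_def cand_set_def A1_def A2_def Z_def space_pair_measure)
    show "let E = (\<lambda>d. {\<omega> \<in> space M. (\<tau>0, \<beta>0) \<in>
                joint_conf_set sel selT X lam \<alpha>1 \<alpha>2 d (\<lambda>b. Us b \<omega>) (response X \<tau>0 \<beta>0 \<sigma>0 (U \<omega>))})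
     in \<exists>c1>0.
       (\<exists>r. r \<in> o(\<lambda>d. exp (- c1 * real d)) \<and>
          (\<forall>d. measure M (E d) \<ge> \<alpha> - \<delta> - r d)) \<and>
       (\<exists>R. (\<forall>d. R d \<in> borel_measurable (gen_sigma M d Us)) \<and>
          small_op M R (\<lambda>d. exp (- c1 * real d)) \<and>
          (\<forall>d. AE \<omega> in M. cond_prob_given M (gen_sigma M d Us) (E d) \<omega> \<ge> \<alpha> - \<delta> - R d \<omega>))"
      unfolding Let_def E
      by (rule coverage_of_random_candidates[where A = ?A and p = q, OF assms(7,8,10)])
         (use q(1) c Z in \<open>auto simp: p_def\<close>)
  qed
qed

end
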